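(* Suppose $0 < \kappa < \cos(\alpha)$. Then for every $g \in SU_2$ the infimum of the cost of admissible decompositions of $g$ is attained on a reduced $n$-optimal word $$g = \exp(t_1 C_1)\exp(t_2 C_2)\cdots\exp(t_n C_n)$$ (for some $n \ge 0$) which satisfies the $\pi$-condition, satisfies $t_p = t_{p+2}$ for all $2 \le p \le n-3$, whose middle time parameters corresponding to $Y$ satisfy $\frac{\pi}{2} \le t_y < \pi$, and which, when $n \ge 4$, satisfies $0 < t_x \le \frac{\pi}{2}$ and $$\frac{\tan(t_y)}{\tan(t_x)} = \frac{\kappa - \cos(\alpha)}{1 - \kappa\cos(\alpha)},$$ understood as $(1-\kappa\cos(\alpha))\sin(t_y)\cos(t_x) = (\kappa-\cos(\alpha))\cos(t_y)\sin(t_x)$.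
   Context: Setting. $SU_2$ is realized as the group of unit quaternions, and its Lie algebra $su_2$ as the space of purely imaginary quaternions with orthonormal basis $i,j,k$. $X, Y \in su_2$ have norm $1$, and $\alpha \in (0,\pi)$ is the angle between them (e.g. $X = i$, $Y = i\cos\alpha + j\sin\alpha$). The set of controls is $S = \{X,Y\}$. The cost factor of $X$ is $1$ and the cost factor of $Y$ is $\kappa$, where $0 \le \kappa \le 1$. An admissible word of length $n \ge 0$ is an expression $\exp(t_1 C_1)\cdots\exp(t_n C_n)$ with $t_i \ge 0$, $C_i \in S$ (for $n=0$ it is the identity). Its cost is $\sum_i \kappa_i t_i$, with $\kappa_i = 1$ if $C_i = X$ and $\kappa_i = \kappa$ if $C_i = Y$. It is reduced if all $t_i > 0$ and $C_i \ne C_{i+1}$ for all $i$. It is $n$-optimal if it has minimum cost among all admissible words of length $n$ equal to the same element of $SU_2$. The infimum of the cost for $g$ is taken over all admissible words of all lengths equal to $g$. The middle time parameters are the $t_i$ with $2 \le i \le n-1$. Here $t_x$ (resp. $t_y$) denotes the common value of the middle time parameters corresponding to $X$ (resp. $Y$); conditions on $t_x$ or $t_y$ are imposed only if a corresponding middle parameter exists. $\pi$-condition: at most one time parameter is $\ge \pi$, and if there is such a parameter, it corresponds to the generator $Y$ and is not a middle time parameter. *)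

theory Defs
  imports "HOL-Analysis.Analysis"
begin

section \<open>Quaternions\<close>

datatype quat = Quat (qre: real) (qi: real) (qj: real) (qk: real)

lemma quat_eq_iff: "p = q \<longleftrightarrow> qre p = qre q \<and> qi p = qi q \<and> qj p = qj q \<and> qk p = qk q"
  by (cases p; cases q) simp

instantiation quat :: real_algebra_1
begin

definition "0 = Quat 0 0 0 0"
definition "1 = Quat 1 0 0 0"
definition "p + q = Quat (qre p + qre q) (qi p + qi q) (qj p + qj q) (qk p + qk q)"
definition "- p = Quat (- qre p) (- qi p) (- qj p) (- qk p)"
definition "p - q = Quat (qre p - qre q) (qi p - qi q) (qj p - qj q) (qk p - qk q)"
definition "r *\<^sub>R p = Quat (r * qre p) (r * qi p) (r * qj p) (r * qk p)"
definition "p * q = Quat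
  (qre p * qre q - qi p * qi q - qj p * qj q - qk p * qk q)
  (qre p * qi q + qi p * qre q + qj p * qk q - qk p * qj q)
  (qre p * qj q - qi p * qk q + qj p * qre q + qk p * qi q)
  (qre p * qk q + qi p * qj q - qj p * qi q + qk p * qre q)"

instance
  by standard
    (simp_all add: quat_eq_iff zero_quat_def one_quat_def plus_quat_def uminus_quat_def
      minus_quat_def scaleR_quat_def times_quat_def algebra_simps)

end

instantiation quat :: real_inner
begin

definition "p \<bullet> q = qre p * qre q + qi p * qi q + qj p * qj q + qk p * qk q"
definition norm_quat :: "quat \<Rightarrow> real" where "norm_quat p = sqrt (p \<bullet> p)"
definition dist_quat :: "quat \<Rightarrow> quat \<Rightarrow> real" where "dist_quat p q = norm (p - q)"
definition sgn_quat :: "quat \<Rightarrow> quat" where "sgn_quat p = p /\<^sub>R norm p"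
definition uniformity_quat :: "(quat \<times> quat) filter"
  where "uniformity_quat = (INF e\<in>{0<..}. principal {(p, q). dist p q < e})"
definition open_quat :: "quat set \<Rightarrow> bool"
  where "open_quat U \<longleftrightarrow> (\<forall>p\<in>U. eventually (\<lambda>(p', q). p' = p \<longrightarrow> q \<in> U) uniformity)"

instance
proof
  fix p q r :: quat and a :: real and U :: "quat set"
  show "p \<bullet> q = q \<bullet> p" "(p + q) \<bullet> r = p \<bullet> r + q \<bullet> r" "(a *\<^sub>R p) \<bullet> q = a * (p \<bullet> q)"
    by (simp_all add: inner_quat_def plus_quat_def scaleR_quat_def algebra_simps)
  show "0 \<le> p \<bullet> p" by (simp add: inner_quat_def)
  show "p \<bullet> p = 0 \<longleftrightarrow> p = 0"
    by (simp add: inner_quat_def quat_eq_iff zero_quat_def add_nonneg_eq_0_iff)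
qed (fact norm_quat_def dist_quat_def sgn_quat_def uniformity_quat_def open_quat_def)+

end

instantiation quat :: euclidean_space
begin

definition "Basis = {Quat 1 0 0 0, Quat 0 1 0 0, Quat 0 0 1 0, Quat 0 0 0 1}"

instance
proof
  show "(Basis :: quat set) \<noteq> {}" "finite (Basis :: quat set)"
    by (simp_all add: Basis_quat_def)
  fix u v p :: quat
  show "u \<in> Basis \<Longrightarrow> v \<in> Basis \<Longrightarrow> u \<bullet> v = (if u = v then 1 else 0)"
    unfolding Basis_quat_def by (elim insertE emptyE; simp add: inner_quat_def)
  show "(\<forall>u\<in>Basis. p \<bullet> u = 0) \<longleftrightarrow> p = 0"
    by (cases p) (simp add: Basis_quat_def inner_quat_def zero_quat_def)
qed

end

instance quat :: real_normed_algebra_1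
proof
  fix p q :: quat
  have "(p * q) \<bullet> (p * q) = (p \<bullet> p) * (q \<bullet> q)"
    by (simp add: inner_quat_def times_quat_def algebra_simps)
  then show "norm (p * q) \<le> norm p * norm q"
    by (simp add: norm_quat_def real_sqrt_mult)
  show "norm (1 :: quat) = 1"
    by (simp add: norm_quat_def inner_quat_def one_quat_def)
qed

definition SU2 :: "quat set"
  where "SU2 = {q. norm q = 1}"

definition su2 :: "quat set"
  where "su2 = {q. qre q = 0}"


section \<open>Words in the controls\<close>

text \<open>The word $\exp(t_1 C_1) \cdots \exp(t_n C_n)$ is represented by the list of the pairs
  $(t_i, C_i)$. Positions are counted from 1.\<close>

type_synonym cword = "(real \<times> quat) list"

definition time :: "cword \<Rightarrow> nat \<Rightarrow> real"
  where "time w p = fst (w ! (p - 1))"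

definition control :: "cword \<Rightarrow> nat \<Rightarrow> quat"
  where "control w p = snd (w ! (p - 1))"

definition admissible :: "quat \<Rightarrow> quat \<Rightarrow> cword \<Rightarrow> bool"
  where "admissible X Y w \<longleftrightarrow> (\<forall>p\<in>{1..length w}. 0 \<le> time w p \<and> control w p \<in> {X, Y})"

definition word_val :: "cword \<Rightarrow> quat"
  where "word_val w = prod_list (map (\<lambda>(t, C). exp (t *\<^sub>R C)) w)"

text \<open>Every control other than \<open>X\<close> gets the cost factor \<open>\<kappa>\<close>; in an admissible word it is \<open>Y\<close>.\<close>

definition cost :: "real \<Rightarrow> quat \<Rightarrow> cword \<Rightarrow> real"
  where "cost \<kappa> X w = (\<Sum>(t, C)\<leftarrow>w. (if C = X then 1 else \<kappa>) * t)"

definition inf_cost :: "real \<Rightarrow> quat \<Rightarrow> quat \<Rightarrow> quat \<Rightarrow> real"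
  where "inf_cost \<kappa> X Y g = Inf {cost \<kappa> X w | w. admissible X Y w \<and> word_val w = g}"

definition reduced_word :: "cword \<Rightarrow> bool"
  where "reduced_word w \<longleftrightarrow>
    (\<forall>p\<in>{1..length w}. 0 < time w p) \<and>
    (\<forall>p\<in>{1..<length w}. control w p \<noteq> control w (p + 1))"

definition n_optimal :: "real \<Rightarrow> quat \<Rightarrow> quat \<Rightarrow> nat \<Rightarrow> cword \<Rightarrow> bool"
  where "n_optimal \<kappa> X Y n w \<longleftrightarrow>
    admissible X Y w \<and> length w = n \<and>
    (\<forall>w'. admissible X Y w' \<and> length w' = n \<and> word_val w' = word_val w \<longrightarrow>
      cost \<kappa> X w \<le> cost \<kappa> X w')"

definition middle :: "cword \<Rightarrow> nat set"
  where "middle w = {p. 2 \<le> p \<and> p \<le> length w - 1}"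

definition pi_condition :: "quat \<Rightarrow> cword \<Rightarrow> bool"
  where "pi_condition Y w \<longleftrightarrow>
    card {p\<in>{1..length w}. pi \<le> time w p} \<le> 1 \<and>
    (\<forall>p\<in>{1..length w}. pi \<le> time w p \<longrightarrow> control w p = Y \<and> p \<notin> middle w)"

end

theory Submission imports Defs begin

text \<open>
  For four consecutive letters \<open>A B A B\<close> the product depends on four times and lives in a
  three-dimensional group, so to first order there is one variation of the times that fixes the
  product. Unless the derivative of the cost along it vanishes, the open mapping theorem yields
  cheaper times; vanishing is the tangent relation between the middle times. Its signs force two
  adjacent middle times to add up to at least \<open>pi / 2\<close>. Hence a word that is cheapest among the words
  of length at most \<open>N\<close> has a length bounded independently of \<open>N\<close>, and the infimum is attained.

  If a middle time of \<open>Y\<close> were smaller than \<open>pi / 2\<close>, the same variation, started at a letter \<open>Y\<close>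
  of time 0 inserted into the following letter \<open>X\<close>, would lower the cost. For the times
  \<open>\<ge> pi\<close> one uses that \<open>exp (pi X) = exp (pi Y) = - 1\<close> is central and cheaper with \<open>Y\<close>.
\<close>

section \<open>Exponentials of imaginary unit quaternions\<close>

lemma norm_quat_mult: "norm (p * q) = norm p * norm (q :: quat)"
proof -
  have "(p * q) \<bullet> (p * q) = (p \<bullet> p) * (q \<bullet> q)"
    by (simp add: inner_quat_def times_quat_def algebra_simps)
  then show ?thesis by (simp add: norm_quat_def real_sqrt_mult)
qed

lemmas quat_ops = zero_quat_def one_quat_def plus_quat_def uminus_quat_def minus_quat_def
  scaleR_quat_def times_quat_def inner_quat_def

lemma su2_anticommute:
  assumes "A \<in> su2" "B \<in> su2"
  shows "A * B + B * A = - (2 * (A \<bullet> B)) *\<^sub>R 1"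
  using assms by (simp add: su2_def quat_eq_iff quat_ops algebra_simps)

lemma unit_su2_square:
  assumes "A \<in> su2" "norm A = 1"
  shows "A * A = - 1"
proof -
  have "A * A = - (A \<bullet> A) *\<^sub>R 1"
    using assms(1) by (simp add: su2_def quat_eq_iff quat_ops algebra_simps)
  with assms(2) show ?thesis by (simp add: norm_eq_1)
qed

text \<open>Multiplying the right-hand side by \<open>exp (t *\<^sub>R (- A))\<close> gives a
  function of derivative 0, hence constantly its value 1 at \<open>t = 0\<close>.\<close>

lemma exp_scaleR_imaginary_unit:
  fixes A :: "'a :: {real_normed_algebra_1, banach}"
  assumes "A * A = - 1"
  shows "exp (t *\<^sub>R A) = cos t *\<^sub>R 1 + sin t *\<^sub>R A"
proof -
  define f where "f t = exp (t *\<^sub>R (- A)) * (cos t *\<^sub>R 1 + sin t *\<^sub>R A)" for t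
  have "(f has_derivative (\<lambda>h. 0)) (at t)" for t
  proof -
    have "(f has_vector_derivative exp (t *\<^sub>R (- A)) * (- sin t *\<^sub>R 1 + cos t *\<^sub>R A)
        + (exp (t *\<^sub>R (- A)) * (- A)) * (cos t *\<^sub>R 1 + sin t *\<^sub>R A)) (at t)"
      unfolding f_def
      by (rule has_vector_derivative_mult exp_scaleR_has_vector_derivative_right derivative_eq_intros refl | simp)+
    also have "exp (t *\<^sub>R (- A)) * (- sin t *\<^sub>R 1 + cos t *\<^sub>R A)
        + (exp (t *\<^sub>R (- A)) * (- A)) * (cos t *\<^sub>R 1 + sin t *\<^sub>R A) = 
       exp (t *\<^sub>R (- A)) * ((- sin t *\<^sub>R 1 + cos t *\<^sub>R A) + (- A) * (cos t *\<^sub>R 1 + sin t *\<^sub>R A))"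
      by (simp only: distrib_left mult.assoc)
    also have "\<dots> = 0" using assms by (simp add: distrib_left)
    finally show ?thesis by (simp add: has_vector_derivative_def)
  qed
  then obtain c where c: "\<And>t. f t = c"
    using has_derivative_zero_constant[of UNIV f] by auto
  from c[of 0] have "c = 1" by (simp add: f_def)
  with c[of t] have "exp (t *\<^sub>R A) * (exp (- (t *\<^sub>R A)) * (cos t *\<^sub>R 1 + sin t *\<^sub>R A)) = exp (t *\<^sub>R A)"
    by (simp add: f_def)
  then show ?thesis by (simp add: mult.assoc[symmetric] exp_minus_inverse)
qed

text \<open>For imaginary unit quaternions this is the rotation of \<open>A\<close> about the axis
  \<open>B\<close> by the angle \<open>2 * t\<close>. The anticommutator relation reduces
  \<open>B * A * B\<close> to \<open>A\<close> and \<open>B\<close>, so everything stays in the span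
  of \<open>A\<close>, \<open>B\<close> and their commutator.\<close>

lemma exp_conjugate_imaginary_unit:
  fixes A B :: "'a :: {real_normed_algebra_1, banach}"
  assumes "A * A = - 1" "B * B = - 1" "A * B + B * A = - (2 * c) *\<^sub>R 1"
  shows "exp (- (t *\<^sub>R B)) * A * exp (t *\<^sub>R B)
    = cos (2 * t) *\<^sub>R A + (c * (1 - cos (2 * t))) *\<^sub>R B + (sin (2 * t) / 2) *\<^sub>R (A * B - B * A)"
proof -
  have AB: "A * B = - (2 * c) *\<^sub>R 1 - B * A" using assms(3) by (simp add: algebra_simps)
  have BAB: "B * A * B = A - (2 * c) *\<^sub>R B"
    unfolding mult.assoc AB using assms(2) by (simp add: right_diff_distrib mult.assoc[symmetric])
  have "exp (- (t *\<^sub>R B)) * A * exp (t *\<^sub>R B)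
      = (cos t *\<^sub>R 1 - sin t *\<^sub>R B) * A * (cos t *\<^sub>R 1 + sin t *\<^sub>R B)"
    using exp_scaleR_imaginary_unit[OF assms(2), of t] exp_scaleR_imaginary_unit[OF assms(2), of "- t"]
    by simp
  also have "\<dots> = (cos t)\<^sup>2 *\<^sub>R A + (sin t * cos t) *\<^sub>R (A * B - B * A) - (sin t)\<^sup>2 *\<^sub>R (B * A * B)"
    by (simp add: algebra_simps power2_eq_square)
  also have "\<dots> = ((cos t)\<^sup>2 - (sin t)\<^sup>2) *\<^sub>R A + (2 * c * (sin t)\<^sup>2) *\<^sub>R B + (sin t * cos t) *\<^sub>R (A * B - B * A)"
    unfolding BAB by (simp add: algebra_simps)
  also have "\<dots> = cos (2 * t) *\<^sub>R A + (c * (1 - cos (2 * t))) *\<^sub>R B + (sin (2 * t) / 2) *\<^sub>R (A * B - B * A)"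
    by (simp add: cos_double sin_double) (simp add: cos_squared_eq)
  finally show ?thesis .
qed

lemma norm_exp_imaginary_unit:
  assumes "A \<in> su2" "norm A = 1"
  shows "norm (exp (t *\<^sub>R A)) = 1"
proof -
  have "norm (exp (t *\<^sub>R A)) ^ 2 = (cos t)\<^sup>2 + (sin t)\<^sup>2 * (A \<bullet> A)"
    unfolding exp_scaleR_imaginary_unit[OF unit_su2_square[OF assms]] power2_norm_eq_inner
    using assms(1) by (simp add: su2_def quat_ops algebra_simps power2_eq_square)
  with assms(2) have "norm (exp (t *\<^sub>R A)) ^ 2 = 1" by (simp add: norm_eq_1)
  then show ?thesis using norm_ge_zero[of "exp (t *\<^sub>R A)"] by (auto simp: power2_eq_1_iff)
qed

lemma exp_scaleR_add: "exp ((s + t) *\<^sub>R (A :: 'a :: {real_normed_algebra_1, banach})) = exp (s *\<^sub>R A) * exp (t *\<^sub>R A)"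
  by (simp add: scaleR_add_left exp_add_commuting)

lemma exp_pi_imaginary_unit:
  fixes A :: "'a :: {real_normed_algebra_1, banach}"
  assumes "A * A = - 1"
  shows "exp (pi *\<^sub>R A) = - 1"
  by (simp add: exp_scaleR_imaginary_unit[OF assms])

text \<open>The commutator is orthogonal to \<open>1\<close>, \<open>A\<close> and \<open>B\<close>
  and has squared norm \<open>4 * (1 - (A \<bullet> B)\<^sup>2)\<close>; \<open>1\<close> is
  orthogonal to \<open>A\<close> and \<open>B\<close>. What remains is the Gram matrix of
  \<open>A\<close> and \<open>B\<close>, of determinant
  \<open>1 - (A \<bullet> B)\<^sup>2\<close>.\<close>

lemma su2_frame_independent:
  assumes A: "A \<in> su2" "norm A = 1" and B: "B \<in> su2" "norm B = 1" and c: "\<bar>A \<bullet> B\<bar> < 1"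
    and eq: "x *\<^sub>R 1 + y *\<^sub>R A + z *\<^sub>R B + w *\<^sub>R (A * B - B * A) = 0"
  shows "x = 0" "y = 0" "z = 0" "w = 0"
proof -
  define N where "N = A * B - B * A"
  have orth: "N \<bullet> A = 0" "N \<bullet> B = 0" "N \<bullet> 1 = 0" "A \<bullet> 1 = 0" "B \<bullet> 1 = 0" "1 \<bullet> (1::quat) = 1"
    using A(1) B(1) by (simp_all add: N_def su2_def quat_ops algebra_simps)
  have AA: "A \<bullet> A = 1" and BB: "B \<bullet> B = 1" using A B by (simp_all add: norm_eq_1)
  have "N \<bullet> N = 4 * ((A \<bullet> A) * (B \<bullet> B) - (A \<bullet> B)\<^sup>2)"
    using A(1) B(1) by (simp add: N_def su2_def quat_ops algebra_simps power2_eq_square)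
  moreover have c2: "(A \<bullet> B)\<^sup>2 < 1" using c by (simp add: abs_square_less_1)
  ultimately have NN: "N \<bullet> N \<noteq> 0" by (simp add: AA BB)
  have eq': "(x *\<^sub>R 1 + y *\<^sub>R A + z *\<^sub>R B + w *\<^sub>R N) \<bullet> v = 0" for v
    using eq by (simp add: N_def)
  show "x = 0" using eq'[of 1] orth by (simp add: inner_simps)
  show "w = 0" using eq'[of N] orth NN by (simp add: inner_simps inner_commute)
  have 1: "y + z * (A \<bullet> B) = 0" using eq'[of A] orth AA by (simp add: inner_simps inner_commute)
  have 2: "z + y * (A \<bullet> B) = 0" using eq'[of B] orth BB by (simp add: inner_simps inner_commute)
  from 1 2 have "y * (1 - (A \<bullet> B)\<^sup>2) = 0" by (simp add: power2_eq_square algebra_simps) algebra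
  with c2 show "y = 0" by simp
  with 2 show "z = 0" by simp
qed

section \<open>Solving equations in a prescribed direction\<close>

lemma linear_injective_imp_surjective_DIM:
  fixes f :: "'a::euclidean_space \<Rightarrow> 'b::euclidean_space"
  assumes "linear f" "inj f" "DIM('a) = DIM('b)"
  shows "surj f"
proof -
  have "dim (range f) = DIM('a)" using assms by (simp add: dim_image_eq)
  then have "span (range f) = UNIV" using assms(3) dim_eq_full by metis
  then show ?thesis using assms(1) by (metis linear_span_image span_UNIV)
qed

text \<open>The open mapping theorem alone reaches the wanted value but does not tell in which
  direction \<open>y\<close> lies. The last estimate does: \<open>y - x\<close> is
  \<open>\<epsilon> *\<^sub>R v\<close> up to a small relative error, which fixes the sign of a
  component that starts at 0.\<close>

lemma directional_solvability:
  fixes f :: "'a::euclidean_space \<Rightarrow> 'b::euclidean_space"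
  assumes cont: "continuous_on UNIV f" and der: "(f has_derivative f') (at x)"
    and inj: "inj f'" and dim: "DIM('a) = DIM('b)" and \<eta>: "0 < \<eta>"
  obtains \<epsilon> y where "0 < \<epsilon>" "f y = f x + \<epsilon> *\<^sub>R f' v" "norm (y - x) \<le> \<eta>" "norm (y - x - \<epsilon> *\<^sub>R v) \<le> \<eta> * \<epsilon>"
proof -
  have lin: "linear f'" using der has_derivative_linear by blast
  have surj: "surj f'" by (rule linear_injective_imp_surjective_DIM[OF lin inj dim])
  define g where "g = inv f'"
  have f'g: "f' (g z) = z" for z unfolding g_def by (rule surj_f_inv_f[OF surj])
  have gf': "g (f' z) = z" for z unfolding g_def by (rule inv_f_f[OF inj])
  have ling: "linear g"
  proof
    show "g (a + b) = g a + g b" for a b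
      using injD[OF inj, of "g (a + b)" "g a + g b"] by (simp add: f'g linear_add[OF lin])
    show "g (r *\<^sub>R b) = r *\<^sub>R g b" for r b
      using injD[OF inj, of "g (r *\<^sub>R b)" "r *\<^sub>R g b"] by (simp add: f'g linear_scale[OF lin])
  qed
  obtain B where B: "B > 0" "\<And>z. norm (g z) \<le> B * norm z" using linear_bounded_pos[OF ling] by auto
  define K where "K = 2 * B * B * (norm (f' v) + 1)"
  have K: "K > 0" using B by (simp add: K_def add_nonneg_pos)
  \<comment> \<open>Accuracy demanded of the linear approximation: \<open>e * B \<le> 1 / 2\<close>
    lets half of \<open>norm z\<close> be absorbed below, so that \<open>norm z\<close> is linear in
    \<open>\<epsilon>\<close>; \<open>e * K \<le> \<eta>\<close> then turns this into the final
    error bound.\<close>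
  define e where "e = min (1 / (2 * B)) (\<eta> / K)"
  have e: "e > 0" "e * B \<le> 1 / 2" "e * K \<le> \<eta>"
    using K B \<eta> by (auto simp: e_def min_def field_simps)
  obtain d where d: "d > 0" "\<And>y. norm (y - x) < d \<Longrightarrow> norm (f y - f x - f' (y - x)) \<le> e * norm (y - x)"
    using der e(1) unfolding has_derivative_at_alt by blast
  have "f x \<in> interior (f ` ball x (min d \<eta>))"
  proof (rule sussmann_open_mapping[OF open_UNIV cont UNIV_I der])
    show "bounded_linear g" using ling linear_conv_bounded_linear by blast
    show "f' \<circ> g = id" by (simp add: fun_eq_iff f'g)
    show "x \<in> interior (ball x (min d \<eta>))" using d(1) \<eta> by simp
  qed simp
  then obtain r where r: "r > 0" "ball (f x) r \<subseteq> f ` ball x (min d \<eta>)"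
    unfolding mem_interior by blast
  \<comment> \<open>Adding 1 keeps the divisor positive when \<open>f' v = 0\<close>; the resulting
    \<open>\<epsilon>\<close> puts the target value within \<open>r / 2\<close> of
    \<open>f x\<close>.\<close>
  define n where "n = norm (f' v) + 1"
  have n: "n > 0" "norm (f' v) \<le> n" by (simp_all add: n_def add_nonneg_pos)
  define \<epsilon> where "\<epsilon> = r / (2 * n)"
  have \<epsilon>: "\<epsilon> > 0" using r(1) n(1) by (simp add: \<epsilon>_def)
  have "norm (\<epsilon> *\<^sub>R f' v) \<le> \<epsilon> * n" using \<epsilon> n by simp
  also have "\<dots> = r / 2" using n(1) by (simp add: \<epsilon>_def)
  finally have "norm (\<epsilon> *\<^sub>R f' v) \<le> r / 2" .
  then have "f x + \<epsilon> *\<^sub>R f' v \<in> ball (f x) r" using r(1) by (simp add: dist_norm)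
  then have "f x + \<epsilon> *\<^sub>R f' v \<in> f ` ball x (min d \<eta>)" using r(2) by blast
  then obtain y where y: "f y = f x + \<epsilon> *\<^sub>R f' v" "norm (y - x) < d" "norm (y - x) < \<eta>"
    by (auto simp: dist_norm norm_minus_commute)
  define z where "z = y - x"
  have bd: "norm (\<epsilon> *\<^sub>R f' v - f' z) \<le> e * norm z" using d(2)[OF y(2)] y(1) by (simp add: z_def)
  have diff: "g (\<epsilon> *\<^sub>R f' v - f' z) = \<epsilon> *\<^sub>R v - z"
    by (simp add: linear_diff[OF ling] linear_scale[OF ling] gf')
  have "norm (\<epsilon> *\<^sub>R v - z) \<le> B * norm (\<epsilon> *\<^sub>R f' v - f' z)" using B(2) diff by metis
  also have "\<dots> \<le> B * (e * norm z)" using B(1) bd by (intro mult_left_mono) auto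
  finally have 1: "norm (\<epsilon> *\<^sub>R v - z) \<le> (e * B) * norm z" by (simp add: mult_ac)
  have "norm z \<le> norm (\<epsilon> *\<^sub>R v) + norm (\<epsilon> *\<^sub>R v - z)"
    by (metis norm_triangle_sub add.commute norm_minus_commute)
  also have "\<dots> \<le> norm (\<epsilon> *\<^sub>R v) + 1 / 2 * norm z"
    using order_trans[OF 1 mult_right_mono[OF e(2)]] by simp
  finally have "norm z \<le> 2 * \<epsilon> * norm v" using \<epsilon> by simp
  also have "norm v \<le> B * (norm (f' v) + 1)"
    using B(2)[of "f' v"] B(1) by (simp add: gf' algebra_simps)
  finally have 2: "norm z \<le> 2 * \<epsilon> * (B * (norm (f' v) + 1))" using \<epsilon> by simp
  have "norm (z - \<epsilon> *\<^sub>R v) \<le> (e * B) * (2 * \<epsilon> * (B * (norm (f' v) + 1)))"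
    using order_trans[OF 1 mult_left_mono[OF 2]] e(1) B(1) by (simp add: norm_minus_commute)
  also have "\<dots> = e * K * \<epsilon>" by (simp add: K_def)
  also have "\<dots> \<le> \<eta> * \<epsilon>" using e(3) \<epsilon> by simp
  finally show ?thesis using that[OF \<epsilon> y(1)] y(3) by (simp add: z_def)
qed

section \<open>First-order variation of four letters\<close>

text \<open>The extra scaling parameter \<open>r\<close> makes the numbers of parameters and of equations agree;
  at points where the second component has norm 1 it is forced to be 1.\<close>

definition four_letters :: "quat \<Rightarrow> quat \<Rightarrow> real \<Rightarrow> real \<Rightarrow> real \<times> real \<times> real \<times> real \<times> real \<Rightarrow> real \<times> quat"
  where "four_letters A B p q = (\<lambda>(r, a, b, c, d). (p * (a + c) + q * (b + d),
    r *\<^sub>R (exp (a *\<^sub>R A) * exp (b *\<^sub>R B) * exp (c *\<^sub>R A) * exp (d *\<^sub>R B))))"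

text \<open>The infinitesimal changes of all four letters are transported to the gap between the
  second and the third. There the outer two letters are conjugated by a single exponential each, and
  the bracket depends on \<open>b\<close> and \<open>c\<close> only.\<close>

definition four_letters_deriv ::
    "quat \<Rightarrow> quat \<Rightarrow> real \<Rightarrow> real \<Rightarrow> real \<times> real \<times> real \<times> real \<Rightarrow> real \<times> real \<times> real \<times> real \<times> real \<Rightarrow> real \<times> quat"
  where "four_letters_deriv A B p q = (\<lambda>(a, b, c, d) (\<rho>, \<alpha>, \<beta>, \<gamma>, \<delta>). (p * (\<alpha> + \<gamma>) + q * (\<beta> + \<delta>),
    exp (a *\<^sub>R A) * exp (b *\<^sub>R B) *
    (\<rho> *\<^sub>R 1 + \<alpha> *\<^sub>R (exp (- (b *\<^sub>R B)) * A * exp (b *\<^sub>R B)) + \<beta> *\<^sub>R B + \<gamma> *\<^sub>R A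
      + \<delta> *\<^sub>R (exp (c *\<^sub>R A) * B * exp (- (c *\<^sub>R A))))
    * (exp (c *\<^sub>R A) * exp (d *\<^sub>R B))))"

lemma norm_fst_snd_le: "norm (fst u) \<le> norm u" "norm (snd u) \<le> norm u"
  by (metis norm_fst_le norm_snd_le prod.collapse)+

lemma has_derivative_exp_scaleR:
  fixes A :: "'a :: {real_normed_algebra_1, banach}"
  assumes "(f has_derivative f') (at x)"
  shows "((\<lambda>x. exp (f x *\<^sub>R A)) has_derivative (\<lambda>h. f' h *\<^sub>R (exp (f x *\<^sub>R A) * A))) (at x)"
  using has_derivative_compose[OF assms
      exp_scaleR_has_vector_derivative_right[unfolded has_vector_derivative_def]] .

lemma continuous_on_exp_scaleR [continuous_intros]:
  fixes A :: "'a :: {real_normed_algebra_1, banach}"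
  assumes "continuous_on S f"
  shows "continuous_on S (\<lambda>x. exp (f x *\<^sub>R A))"
proof -
  have "continuous_on UNIV (\<lambda>t. exp (t *\<^sub>R A))"
    by (intro continuous_at_imp_continuous_on ballI
      has_vector_derivative_continuous[OF exp_scaleR_has_vector_derivative_right])
  from continuous_on_compose2[OF this assms] show ?thesis by simp
qed

lemma four_letters_has_derivative:
  "(four_letters A B p q has_derivative four_letters_deriv A B p q (a, b, c, d)) (at (1, a, b, c, d))"
proof -
  have inv: "exp (b *\<^sub>R B) * (exp (- (b *\<^sub>R B)) * z) = z" "exp (- (c *\<^sub>R A)) * (exp (c *\<^sub>R A) * z) = z" for z
    using exp_minus_inverse[of "b *\<^sub>R B"] exp_minus_inverse[of "- (c *\<^sub>R A)"]
    by (simp_all add: mult.assoc[symmetric])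
  have comm: "exp (d *\<^sub>R B) * B = B * exp (d *\<^sub>R B)"
    by (rule exp_times_scaleR_commute)
  have commA: "exp (c *\<^sub>R A) * (A * z) = A * (exp (c *\<^sub>R A) * z)" for z
    by (simp add: mult.assoc[symmetric] exp_times_scaleR_commute)
  let ?x = "(1 :: real, a, b, c, d)"
  have r: "(fst has_derivative fst) (at ?x)"
    and a: "((\<lambda>x. fst (snd x)) has_derivative (\<lambda>h. fst (snd h))) (at ?x)"
    and b: "((\<lambda>x. fst (snd (snd x))) has_derivative (\<lambda>h. fst (snd (snd h)))) (at ?x)"
    and c: "((\<lambda>x. fst (snd (snd (snd x)))) has_derivative (\<lambda>h. fst (snd (snd (snd h))))) (at ?x)"
    and d: "((\<lambda>x. snd (snd (snd (snd x)))) has_derivative (\<lambda>h. snd (snd (snd (snd h))))) (at ?x)"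
    by (intro bounded_linear_imp_has_derivative bounded_linear_fst bounded_linear_snd
      bounded_linear_fst_comp bounded_linear_snd_comp)+
  note word = has_derivative_mult[OF has_derivative_mult[OF has_derivative_mult[OF
      has_derivative_exp_scaleR[OF a, of A] has_derivative_exp_scaleR[OF b, of B]]
      has_derivative_exp_scaleR[OF c, of A]] has_derivative_exp_scaleR[OF d, of B]]
  note cost = has_derivative_add[OF has_derivative_mult_right[OF has_derivative_add[OF a c], of p]
      has_derivative_mult_right[OF has_derivative_add[OF b d], of q]]
  show ?thesis
    unfolding four_letters_def case_prod_beta
    by (rule has_derivative_eq_rhs[OF has_derivative_Pair[OF cost has_derivative_scaleR[OF r word]]])
      (simp only: fun_eq_iff four_letters_deriv_def case_prod_beta fst_conv snd_conv prod.inject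
        scaleR_one mult_1_right mult_1_left comm commA inv distrib_left distrib_right mult.assoc
        scaleR_add_right mult_scaleR_left mult_scaleR_right scaleR_scaleR add_ac simp_thms)
qed

lemma continuous_four_letters: "continuous_on UNIV (four_letters A B p q)"
  unfolding four_letters_def case_prod_beta by (intro continuous_intros)

text \<open>The variation that keeps the product of the four letters fixed to first order.\<close>

definition fibre_direction ::
    "real \<Rightarrow> real \<Rightarrow> real \<Rightarrow> real \<times> real \<times> real \<times> real \<times> real"
  where "fibre_direction s b c = (0, sin (2 * c),
    s * (cos (2 * b) - 1) * sin (2 * c) + sin (2 * b) * cos (2 * c),
    - cos (2 * b) * sin (2 * c) + s * sin (2 * b) * (1 - cos (2 * c)),
    - sin (2 * b))"

text \<open>Up to the factor \<open>4 * sin b * sin c\<close> this is the derivative of the cost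
  along \<open>fibre_direction\<close>; it vanishes exactly when the tangent relation, cleared of
  denominators, holds.\<close>

definition stationarity :: "real \<Rightarrow> real \<Rightarrow> real \<Rightarrow> real \<Rightarrow> real \<Rightarrow> real"
  where "stationarity s p q b c = (p - q * s) * sin b * cos c - (q - p * s) * cos b * sin c"

locale unit_pair =
  fixes A B :: quat
  assumes A: "A \<in> su2" "norm A = 1" and B: "B \<in> su2" "norm B = 1" and AB: "\<bar>A \<bullet> B\<bar> < 1"
begin

lemma deriv_frame:
  "four_letters_deriv A B p q (a, b, c, d) (\<rho>, \<alpha>, \<beta>, \<gamma>, \<delta>) = (p * (\<alpha> + \<gamma>) + q * (\<beta> + \<delta>),
    exp (a *\<^sub>R A) * exp (b *\<^sub>R B) *
    (\<rho> *\<^sub>R 1 + (\<alpha> * cos (2 * b) + \<gamma> + \<delta> * ((A \<bullet> B) * (1 - cos (2 * c)))) *\<^sub>R A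
     + (\<alpha> * ((A \<bullet> B) * (1 - cos (2 * b))) + \<beta> + \<delta> * cos (2 * c)) *\<^sub>R B
     + (\<alpha> * sin (2 * b) / 2 + \<delta> * sin (2 * c) / 2) *\<^sub>R (A * B - B * A))
    * (exp (c *\<^sub>R A) * exp (d *\<^sub>R B)))"
proof -
  have 1: "exp (- (b *\<^sub>R B)) * A * exp (b *\<^sub>R B) = cos (2 * b) *\<^sub>R A
      + ((A \<bullet> B) * (1 - cos (2 * b))) *\<^sub>R B + (sin (2 * b) / 2) *\<^sub>R (A * B - B * A)"
    by (intro exp_conjugate_imaginary_unit unit_su2_square su2_anticommute A B)
  \<comment> \<open>In the second conjugation the roles of \<open>A\<close> and \<open>B\<close> are
    exchanged and the inverse stands on the right, hence the time \<open>- c\<close>.\<close>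
  have "exp (- ((- c) *\<^sub>R A)) * B * exp ((- c) *\<^sub>R A) = cos (2 * (- c)) *\<^sub>R B
      + ((B \<bullet> A) * (1 - cos (2 * (- c)))) *\<^sub>R A + (sin (2 * (- c)) / 2) *\<^sub>R (B * A - A * B)"
    by (intro exp_conjugate_imaginary_unit unit_su2_square su2_anticommute A B)
  then have 2: "exp (c *\<^sub>R A) * B * exp (- (c *\<^sub>R A)) = cos (2 * c) *\<^sub>R B
      + ((A \<bullet> B) * (1 - cos (2 * c))) *\<^sub>R A + (sin (2 * c) / 2) *\<^sub>R (A * B - B * A)"
    by (simp add: inner_commute scaleR_right_diff_distrib)
  show ?thesis unfolding four_letters_deriv_def case_prod_conv 1 2
    by (simp add: algebra_simps add_divide_distrib)
qed

text \<open>The ratio of the outer changes, \<open>sin (2 * c)\<close> to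
  \<open>- sin (2 * b)\<close>, cancels the commutator coordinate; the two inner changes are then
  determined by the coordinates of \<open>A\<close> and \<open>B\<close>.\<close>

lemma deriv_fibre_direction:
  "four_letters_deriv A B p q (a, b, c, d) (fibre_direction (A \<bullet> B) b c)
    = (4 * sin b * sin c * stationarity (A \<bullet> B) p q b c, 0)"
proof -
  have "p * (sin (2 * c) + (- cos (2 * b) * sin (2 * c) + (A \<bullet> B) * sin (2 * b) * (1 - cos (2 * c))))
    + q * (((A \<bullet> B) * (cos (2 * b) - 1) * sin (2 * c) + sin (2 * b) * cos (2 * c)) - sin (2 * b))
    = 4 * sin b * sin c * stationarity (A \<bullet> B) p q b c"
    unfolding stationarity_def cos_double_sin sin_double by (simp add: algebra_simps power2_eq_square)
  then show ?thesis
    unfolding fibre_direction_def deriv_frame by (simp add: algebra_simps)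
qed

text \<open>The directions that fix the product to first order are the multiples of
  \<open>fibre_direction\<close>, and along these the cost has nonzero derivative.\<close>

lemma inj_deriv:
  assumes "stationarity (A \<bullet> B) p q b c \<noteq> 0" "sin b \<noteq> 0" "sin c \<noteq> 0"
  shows "inj (four_letters_deriv A B p q (a, b, c, d))"
proof -
  have lin: "linear (four_letters_deriv A B p q (a, b, c, d))"
    using four_letters_has_derivative has_derivative_linear by blast
  have "v = 0" if v: "four_letters_deriv A B p q (a, b, c, d) v = 0" for v
  proof -
    obtain \<rho> \<alpha> \<beta> \<gamma> \<delta> where v_eq: "v = (\<rho>, \<alpha>, \<beta>, \<gamma>, \<delta>)" by (metis surj_pair)
    let ?x = "\<alpha> * cos (2 * b) + \<gamma> + \<delta> * ((A \<bullet> B) * (1 - cos (2 * c)))"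
    let ?y = "\<alpha> * ((A \<bullet> B) * (1 - cos (2 * b))) + \<beta> + \<delta> * cos (2 * c)"
    let ?z = "\<alpha> * sin (2 * b) / 2 + \<delta> * sin (2 * c) / 2"
    let ?M = "\<rho> *\<^sub>R 1 + ?x *\<^sub>R A + ?y *\<^sub>R B + ?z *\<^sub>R (A * B - B * A)"
    have cost: "p * (\<alpha> + \<gamma>) + q * (\<beta> + \<delta>) = 0"
      and "exp (a *\<^sub>R A) * exp (b *\<^sub>R B) * ?M * (exp (c *\<^sub>R A) * exp (d *\<^sub>R B)) = 0"
      using v unfolding v_eq deriv_frame by (simp_all add: zero_prod_def)
    then have "norm (exp (a *\<^sub>R A) * exp (b *\<^sub>R B) * ?M * (exp (c *\<^sub>R A) * exp (d *\<^sub>R B))) = 0" by simp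
    then have "norm ?M = 0" unfolding norm_quat_mult by (simp add: norm_exp_imaginary_unit A B)
    then have "?M = 0" by simp
    from su2_frame_independent[OF A B AB this]
    have \<rho>: "\<rho> = 0" and x: "?x = 0" and y: "?y = 0" and z: "?z = 0" by blast+
    \<comment> \<open>If both vanished, then \<open>cos b = cos c = 0\<close>, and with them
      \<open>stationarity\<close> would be 0.\<close>
    have "sin (2 * b) \<noteq> 0 \<or> sin (2 * c) \<noteq> 0"
      using assms by (auto simp: sin_double stationarity_def)
    then obtain k where k: "\<alpha> = k * sin (2 * c)" "\<delta> = - k * sin (2 * b)"
    proof
      assume "sin (2 * b) \<noteq> 0"
      with z show ?thesis by (intro that[of "- \<delta> / sin (2 * b)"]) (auto simp: field_simps)
    next
      assume "sin (2 * c) \<noteq> 0"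
      with z show ?thesis by (intro that[of "\<alpha> / sin (2 * c)"]) (auto simp: field_simps)
    qed
    have v': "v = k *\<^sub>R fibre_direction (A \<bullet> B) b c"
      using x y by (simp add: v_eq fibre_direction_def \<rho> k algebra_simps)
    have "four_letters_deriv A B p q (a, b, c, d) v = k *\<^sub>R (4 * sin b * sin c * stationarity (A \<bullet> B) p q b c, 0)"
      unfolding v' linear_scale[OF lin] deriv_fibre_direction ..
    then have "k = 0" using v assms by (auto simp: zero_prod_def)
    then show "v = 0" using v' by simp
  qed
  then show ?thesis by (simp add: linear_injective_0[OF lin])
qed

lemma unit_word4: "norm (exp (a *\<^sub>R A) * exp (b *\<^sub>R B) * exp (c *\<^sub>R A) * exp (d *\<^sub>R B)) = 1"
  by (simp add: norm_quat_mult norm_exp_imaginary_unit A B)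

lemma four_letters_unit_scale:
  assumes "four_letters A B p q (r, a, b, c, d) = (m, g)" "norm g = 1" "r > 0"
  shows "p * (a + c) + q * (b + d) = m"
    "exp (a *\<^sub>R A) * exp (b *\<^sub>R B) * exp (c *\<^sub>R A) * exp (d *\<^sub>R B) = g"
proof -
  let ?h = "exp (a *\<^sub>R A) * exp (b *\<^sub>R B) * exp (c *\<^sub>R A) * exp (d *\<^sub>R B)"
  have 1: "p * (a + c) + q * (b + d) = m" "r *\<^sub>R ?h = g"
    using assms(1) by (simp_all add: four_letters_def)
  from 1(2) have "\<bar>r\<bar> * norm ?h = norm g" by auto
  with assms have "r = 1" unfolding unit_word4 by simp
  with 1 show "p * (a + c) + q * (b + d) = m" "?h = g" by auto
qed

lemma DIM_four_letters: "DIM(real \<times> real \<times> real \<times> real \<times> real) = DIM(real \<times> quat)"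
  by (simp add: Basis_quat_def)

text \<open>A vanishing last time may only increase, which the sign condition allows for.\<close>

lemma improvable:
  assumes "0 < a" "0 < b" "b < pi" "0 < c" "c < pi" "0 \<le> d"
    and s: "stationarity (A \<bullet> B) p q b c \<noteq> 0" and d0: "d = 0 \<Longrightarrow> 0 < stationarity (A \<bullet> B) p q b c * cos b"
  obtains a' b' c' d' where "0 < a'" "0 < b'" "0 < c'" "0 < d'"
    "exp (a' *\<^sub>R A) * exp (b' *\<^sub>R B) * exp (c' *\<^sub>R A) * exp (d' *\<^sub>R B)
      = exp (a *\<^sub>R A) * exp (b *\<^sub>R B) * exp (c *\<^sub>R A) * exp (d *\<^sub>R B)"
    "p * (a' + c') + q * (b' + d') < p * (a + c) + q * (b + d)"
proof -
  define S where "S = stationarity (A \<bullet> B) p q b c"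
  have sb: "sin b > 0" and sc: "sin c > 0" using assms by (simp_all add: sin_gt_zero)
  \<comment> \<open>This factor normalizes the direction \<open>v\<close> below: along
    \<open>v\<close> the cost falls at rate 1 and the product is stationary.\<close>
  define k where "k = 1 / (4 * sin b * sin c * S)"
  have k: "k * (4 * sin b * sin c * S) = 1" using sb sc s by (simp add: k_def S_def)
  define v where "v = (- k) *\<^sub>R fibre_direction (A \<bullet> B) b c"
  let ?w = "exp (a *\<^sub>R A) * exp (b *\<^sub>R B) * exp (c *\<^sub>R A) * exp (d *\<^sub>R B)"
  let ?D = "four_letters_deriv A B p q (a, b, c, d)"
  define vd where "vd = k * sin (2 * b)"
  have v_d: "snd (snd (snd (snd v))) = vd" by (simp add: v_def fibre_direction_def vd_def)
  have lin: "linear ?D" using four_letters_has_derivative has_derivative_linear by blast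
  have Dv: "?D v = (- 1, 0)"
    unfolding v_def linear_scale[OF lin] deriv_fibre_direction using k by (simp add: S_def)
  have vd_pos: "vd > 0" if "d = 0"
  proof -
    have "vd = cos b * S / (2 * sin c * S\<^sup>2)"
      using sb sc s by (simp add: vd_def k_def sin_double S_def power2_eq_square)
    moreover have "S\<^sup>2 > 0" using s by (simp add: S_def)
    ultimately show ?thesis using d0[OF that] sc by (simp add: S_def mult.commute)
  qed
  \<comment> \<open>No positive time loses more than half of its value, and \<open>1 / 2\<close>
    keeps \<open>r\<close> positive. For \<open>d = 0\<close> the error stays below half of the
    drift \<open>vd\<close>, so the last time becomes positive.\<close>
  define \<eta> where "\<eta> = Min {1 / 2, a / 2, b / 2, c / 2, if d = 0 then vd / 2 else d / 2}"
  have "0 < \<eta>" using assms vd_pos by (simp add: \<eta>_def)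
  have "\<eta> \<le> x" if "x \<in> {1 / 2, a / 2, b / 2, c / 2, if d = 0 then vd / 2 else d / 2}" for x
    unfolding \<eta>_def using that by (intro Min_le) auto
  then have \<eta>: "\<eta> \<le> 1 / 2" "\<eta> \<le> a / 2" "\<eta> \<le> b / 2" "\<eta> \<le> c / 2" "\<eta> \<le> (if d = 0 then vd / 2 else d / 2)"
    by blast+
  obtain \<epsilon> y where \<epsilon>: "\<epsilon> > 0"
    and fy: "four_letters A B p q y = four_letters A B p q (1, a, b, c, d) + \<epsilon> *\<^sub>R ?D v"
    and near: "norm (y - (1, a, b, c, d)) \<le> \<eta>"
    and tang: "norm (y - (1, a, b, c, d) - \<epsilon> *\<^sub>R v) \<le> \<eta> * \<epsilon>"
    using directional_solvability[OF continuous_four_letters four_letters_has_derivative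
      inj_deriv[OF s less_imp_neq[OF sb, symmetric] less_imp_neq[OF sc, symmetric]]
      DIM_four_letters \<open>0 < \<eta>\<close>, of a d v] .
  obtain r a' b' c' d' where y: "y = (r, a', b', c', d')" by (metis surj_pair)
  define z where "z = y - (1, a, b, c, d)"
  have "norm (fst z) \<le> \<eta>" "norm (fst (snd z)) \<le> \<eta>" "norm (fst (snd (snd z))) \<le> \<eta>"
    "norm (fst (snd (snd (snd z)))) \<le> \<eta>" "norm (snd (snd (snd (snd z)))) \<le> \<eta>"
    using near norm_fst_snd_le[of z] norm_fst_snd_le[of "snd z"] norm_fst_snd_le[of "snd (snd z)"]
      norm_fst_snd_le[of "snd (snd (snd z))"]
    unfolding z_def[symmetric] by (meson order_trans)+
  then have near': "\<bar>r - 1\<bar> \<le> \<eta>" "\<bar>a' - a\<bar> \<le> \<eta>" "\<bar>b' - b\<bar> \<le> \<eta>" "\<bar>c' - c\<bar> \<le> \<eta>" "\<bar>d' - d\<bar> \<le> \<eta>"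
    by (simp_all add: z_def y)
  have tang': "\<bar>d' - d - \<epsilon> * vd\<bar> \<le> \<eta> * \<epsilon>"
  proof -
    have "\<bar>d' - d - \<epsilon> * vd\<bar> = norm (snd (snd (snd (snd (y - (1, a, b, c, d) - \<epsilon> *\<^sub>R v)))))"
      by (simp add: y v_d)
    also have "\<dots> \<le> norm (y - (1, a, b, c, d) - \<epsilon> *\<^sub>R v)"
      by (intro order_trans[OF norm_fst_snd_le(2)] order_refl)
    finally show ?thesis using tang by simp
  qed
  have pos: "r > 0" "a' > 0" "b' > 0" "c' > 0" using near' \<eta> assms by linarith+
  have "d' > 0"
  proof (cases "d = 0")
    case True
    have "\<eta> * \<epsilon> \<le> (vd / 2) * \<epsilon>" using \<eta>(5) \<epsilon> True by (intro mult_right_mono) auto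
    moreover have "vd * \<epsilon> > 0" using vd_pos[OF True] \<epsilon> by simp
    ultimately show ?thesis using tang' True by (simp add: mult.commute)
  next
    case False
    then show ?thesis using near' \<eta> assms by auto
  qed
  have "four_letters A B p q (r, a', b', c', d') = (p * (a + c) + q * (b + d) - \<epsilon>, ?w)"
    using fy unfolding y Dv by (simp add: four_letters_def)
  from four_letters_unit_scale[OF this unit_word4 pos(1)]
  show ?thesis using that[OF pos(2-) \<open>d' > 0\<close>] \<epsilon> by simp
qed

text \<open>With all times \<open>pi / 4\<close> and the auxiliary weights 1 and 0,
  \<open>stationarity\<close> is \<open>(1 + A \<bullet> B) / 2\<close>, which is nonzero, so the
  derivative is bijective. Keeping the cost coordinate at its central value leaves a neighbourhood
  of \<open>h\<close> in the unit sphere.\<close>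

lemma four_letters_locally_onto:
  obtains e h where "e > 0" "norm h = 1"
    "\<And>g. norm g = 1 \<Longrightarrow> dist h g < e \<Longrightarrow> \<exists>a b c d. 0 < a \<and> 0 < b \<and> 0 < c \<and> 0 < d \<and>
      exp (a *\<^sub>R A) * exp (b *\<^sub>R B) * exp (c *\<^sub>R A) * exp (d *\<^sub>R B) = g"
proof -
  let ?t = "pi / 4"
  let ?x = "(1, ?t, ?t, ?t, ?t)"
  let ?f = "four_letters A B 1 0" and ?D = "four_letters_deriv A B 1 0 (?t, ?t, ?t, ?t)"
  let ?h = "exp (?t *\<^sub>R A) * exp (?t *\<^sub>R B) * exp (?t *\<^sub>R A) * exp (?t *\<^sub>R B)"
  define T where "T = {0::real<..} \<times> {0::real<..} \<times> {0::real<..} \<times> {0::real<..} \<times> {0::real<..}"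
  have T: "open T" "?x \<in> T" by (auto simp: T_def intro!: open_Times)
  have "stationarity (A \<bullet> B) 1 0 ?t ?t = (1 + A \<bullet> B) / 2"
    by (simp add: stationarity_def sin_45 cos_45 algebra_simps)
  then have "inj ?D" using AB by (intro inj_deriv) (auto simp: sin_45)
  moreover have "linear ?D" using four_letters_has_derivative has_derivative_linear by blast
  ultimately have "surj ?D" by (intro linear_injective_imp_surjective_DIM DIM_four_letters)
  with \<open>linear ?D\<close> obtain g' where g': "linear g'" "?D \<circ> g' = id"
    using linear_surjective_right_inverse by blast
  have "?f ?x \<in> interior (?f ` T)"
    using T g' by (intro sussmann_open_mapping[OF open_UNIV continuous_four_letters UNIV_I four_letters_has_derivative])
      (auto simp: linear_conv_bounded_linear interior_open)
  then obtain e where e: "e > 0" "ball (?f ?x) e \<subseteq> ?f ` T" unfolding mem_interior by blast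
  show ?thesis
  proof (rule that[OF e(1) unit_word4[of ?t ?t ?t ?t]])
    fix g :: quat assume g: "norm g = 1" "dist ?h g < e"
    then have "(?t + ?t, g) \<in> ball (?f ?x) e" by (simp add: four_letters_def dist_Pair_Pair)
    then have "(?t + ?t, g) \<in> ?f ` T" using e(2) by blast
    then obtain y where "y \<in> T" "?f y = (?t + ?t, g)" by (metis imageE)
    then obtain r a b c d where y: "(r, a, b, c, d) \<in> T" "?f (r, a, b, c, d) = (?t + ?t, g)"
      by (metis surj_pair)
    then show "\<exists>a b c d. 0 < a \<and> 0 < b \<and> 0 < c \<and> 0 < d \<and>
      exp (a *\<^sub>R A) * exp (b *\<^sub>R B) * exp (c *\<^sub>R A) * exp (d *\<^sub>R B) = g"
      using four_letters_unit_scale(2)[OF y(2) g(1)] by (auto simp: T_def)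
  qed
qed

end

section \<open>Words\<close>

lemma ball_positions: "(\<forall>p\<in>{1..length w}. P (w ! (p - 1))) \<longleftrightarrow> (\<forall>x\<in>set w. P x)"
proof -
  have "{1..length w} = Suc ` {..<length w}"
    by (auto simp: image_iff lessThan_atLeast0 Suc_le_eq gr0_conv_Suc intro!: bexI[of _ "x - 1" for x])
  then show ?thesis by (auto simp: all_set_conv_all_nth)
qed

lemma admissible_iff: "admissible X Y w \<longleftrightarrow> (\<forall>x\<in>set w. 0 \<le> fst x \<and> snd x \<in> {X, Y})"
  unfolding admissible_def time_def control_def by (rule ball_positions)

lemma admissible_simps [simp]:
  "admissible X Y []"
  "admissible X Y (x # w) \<longleftrightarrow> 0 \<le> fst x \<and> snd x \<in> {X, Y} \<and> admissible X Y w"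
  "admissible X Y (v @ w) \<longleftrightarrow> admissible X Y v \<and> admissible X Y w"
  by (auto simp: admissible_iff)

lemma reduced_word_iff:
  "reduced_word w \<longleftrightarrow> (\<forall>x\<in>set w. 0 < fst x) \<and> successively (\<lambda>x y. snd x \<noteq> snd y) w"
proof -
  have "{1..<length w} = Suc ` {..<length w - 1}" by (auto simp: image_iff Suc_le_eq gr0_conv_Suc)
  then have "(\<forall>p\<in>{1..<length w}. control w p \<noteq> control w (p + 1)) \<longleftrightarrow>
      (\<forall>i<length w - 1. snd (w ! i) \<noteq> snd (w ! Suc i))"
    by (auto simp: control_def)
  then show ?thesis
    unfolding reduced_word_def time_def ball_positions[of w "\<lambda>x. 0 < fst x"] successively_conv_nth
    by (auto simp: less_diff_conv)
qed

lemma word_val_simps [simp]: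
  "word_val [] = 1" "word_val ((t, C) # w) = exp (t *\<^sub>R C) * word_val w"
  "word_val (v @ w) = word_val v * word_val w"
  by (simp_all add: word_val_def)

lemma cost_simps [simp]:
  "cost \<kappa> X [] = 0" "cost \<kappa> X ((t, C) # w) = (if C = X then 1 else \<kappa>) * t + cost \<kappa> X w"
  "cost \<kappa> X (v @ w) = cost \<kappa> X v + cost \<kappa> X w"
  by (simp_all add: cost_def)

text \<open>Letters of time 0 are dropped and equal neighbours merged; exponentials and costs of one
  control are additive in the time.\<close>

lemma reduced_word_exists:
  assumes "admissible X Y w"
  shows "\<exists>v. admissible X Y v \<and> reduced_word v \<and> word_val v = word_val w
    \<and> cost \<kappa> X v = cost \<kappa> X w \<and> length v \<le> length w"
  using assms
proof (induction w)
  case Nil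
  then show ?case by (intro exI[of _ "[]"]) (simp add: reduced_word_iff)
next
  case (Cons x w)
  obtain t C where x: "x = (t, C)" by fastforce
  from Cons obtain v where v: "admissible X Y v" "reduced_word v" "word_val v = word_val w"
    "cost \<kappa> X v = cost \<kappa> X w" "length v \<le> length w" by auto
  have t: "t \<ge> 0" "C \<in> {X, Y}" using Cons.prems by (auto simp: x)
  consider "t = 0" | "t > 0" "v = []" | s u where "t > 0" "v = (s, C) # u"
    | s D u where "t > 0" "v = (s, D) # u" "C \<noteq> D"
    using t by (metis list.exhaust surj_pair less_eq_real_def)
  then show ?case
  proof cases
    case 1
    then show ?thesis using v by (intro exI[of _ v]) (simp add: x)
  next
    case 2
    then show ?thesis using v t by (intro exI[of _ "[(t, C)]"]) (auto simp: x reduced_word_iff)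
  next
    case 3
    then show ?thesis using v t
      by (intro exI[of _ "(t + s, C) # u"])
        (auto simp: x reduced_word_iff successively_Cons exp_scaleR_add mult.assoc distrib_left add_pos_pos)
  next
    case 4
    then show ?thesis using v t
      by (intro exI[of _ "(t, C) # v"]) (auto simp: x reduced_word_iff)
  qed
qed

text \<open>Unlike in \<open>n_optimal\<close>, words shorter than \<open>N\<close> compete as well,
  so that passing to a reduced word stays within the class.\<close>

definition optimal :: "real \<Rightarrow> quat \<Rightarrow> quat \<Rightarrow> nat \<Rightarrow> cword \<Rightarrow> bool"
  where "optimal \<kappa> X Y N w \<longleftrightarrow> admissible X Y w \<and> length w \<le> N \<and>
    (\<forall>v. admissible X Y v \<and> length v \<le> N \<and> word_val v = word_val w \<longrightarrow> cost \<kappa> X w \<le> cost \<kappa> X v)"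

definition globally_optimal :: "real \<Rightarrow> quat \<Rightarrow> quat \<Rightarrow> cword \<Rightarrow> bool"
  where "globally_optimal \<kappa> X Y w \<longleftrightarrow> admissible X Y w \<and>
    (\<forall>v. admissible X Y v \<and> word_val v = word_val w \<longrightarrow> cost \<kappa> X w \<le> cost \<kappa> X v)"

lemma globally_optimal_imp_optimal: "globally_optimal \<kappa> X Y w \<Longrightarrow> length w \<le> N \<Longrightarrow> optimal \<kappa> X Y N w"
  by (simp add: optimal_def globally_optimal_def)

lemma optimal_replace:
  assumes "optimal \<kappa> X Y N (u @ m @ v)" "admissible X Y m'" "word_val m' = word_val m"
    "length (u @ m' @ v) \<le> N"
  shows "cost \<kappa> X m \<le> cost \<kappa> X m'"
proof -
  have "cost \<kappa> X (u @ m @ v) \<le> cost \<kappa> X (u @ m' @ v)"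
    using assms unfolding optimal_def by (metis admissible_simps(3) word_val_simps(3))
  then show ?thesis by simp
qed

lemma globally_optimal_replace:
  assumes "globally_optimal \<kappa> X Y (u @ m @ v)" "admissible X Y m'" "word_val m' = word_val m"
  shows "cost \<kappa> X m \<le> cost \<kappa> X m'"
  using optimal_replace[OF globally_optimal_imp_optimal[OF assms(1)] assms(2,3), of "max (length (u @ m @ v)) (length (u @ m' @ v))"]
  by simp

section \<open>Compactness of the attainable pairs of cost and value\<close>

text \<open>The last conjunct bounds the times, which makes the set compact.\<close>

definition attainable :: "real \<Rightarrow> quat \<Rightarrow> quat \<Rightarrow> real \<Rightarrow> nat \<Rightarrow> (real \<times> quat) set"
  where "attainable \<kappa> X Y T N =
    {(cost \<kappa> X w, word_val w) | w. admissible X Y w \<and> length w \<le> N \<and> (\<forall>x\<in>set w. fst x \<le> T)}"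

text \<open>Peeling off the first letter yields a finite union of continuous images of products with
  an interval, the induction step for compactness.\<close>

lemma attainable_Suc:
  "attainable \<kappa> X Y T (Suc N) = insert (0, 1) (\<Union>C\<in>{X, Y}.
    (\<lambda>(t, c, g). ((if C = X then 1 else \<kappa>) * t + c, exp (t *\<^sub>R C) * g)) ` ({0..T} \<times> attainable \<kappa> X Y T N))"
  (is "_ = ?R")
proof (intro set_eqI iffI)
  fix z assume "z \<in> attainable \<kappa> X Y T (Suc N)"
  then obtain w where w: "z = (cost \<kappa> X w, word_val w)" "admissible X Y w" "length w \<le> Suc N" "\<forall>x\<in>set w. fst x \<le> T"
    by (auto simp: attainable_def)
  show "z \<in> ?R"
  proof (cases w)
    case Nil
    with w show ?thesis by simp
  next
    case (Cons x v)
    obtain t C where x: "x = (t, C)" by fastforce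
    have "C \<in> {X, Y}" "(t, cost \<kappa> X v, word_val v) \<in> {0..T} \<times> attainable \<kappa> X Y T N"
      using w by (auto simp: Cons x attainable_def)
    moreover have "z = (\<lambda>(t, c, g). ((if C = X then 1 else \<kappa>) * t + c, exp (t *\<^sub>R C) * g))
        (t, cost \<kappa> X v, word_val v)"
      using w(1) by (simp add: Cons x)
    ultimately show ?thesis by (blast intro: image_eqI)
  qed
next
  fix z assume "z \<in> ?R"
  show "z \<in> attainable \<kappa> X Y T (Suc N)"
  proof (cases "z = (0, 1)")
    case True
    then show ?thesis by (auto simp: attainable_def intro!: exI[of _ "[]"])
  next
    case False
    with \<open>z \<in> ?R\<close> obtain C where C: "C \<in> {X, Y}" and
      z: "z \<in> (\<lambda>(t, c, g). ((if C = X then 1 else \<kappa>) * t + c, exp (t *\<^sub>R C) * g)) ` ({0..T} \<times> attainable \<kappa> X Y T N)"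
      by blast
    from z obtain t w where w: "t \<in> {0..T}" "admissible X Y w" "length w \<le> N" "\<forall>x\<in>set w. fst x \<le> T"
      and z: "z = (cost \<kappa> X ((t, C) # w), word_val ((t, C) # w))"
      by (auto simp: attainable_def)
    have "admissible X Y ((t, C) # w) \<and> length ((t, C) # w) \<le> Suc N \<and> (\<forall>x\<in>set ((t, C) # w). fst x \<le> T)"
      using w C by auto
    then show ?thesis unfolding attainable_def z by blast
  qed
qed

lemma compact_attainable: "compact (attainable \<kappa> X Y T N)"
proof (induction N)
  case 0
  have "attainable \<kappa> X Y T 0 = {(0, 1)}" by (auto simp: attainable_def)
  then show ?case by simp
next
  case (Suc N)
  have "compact ((\<lambda>(t, c, g). ((if C = X then 1 else \<kappa>) * t + c, exp (t *\<^sub>R C) * g)) ` ({0..T} \<times> attainable \<kappa> X Y T N))" for C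
    unfolding case_prod_beta
    by (intro compact_continuous_image compact_Times Suc compact_Icc continuous_intros)
  then show ?case unfolding attainable_Suc
    by (intro compact_insert compact_UN) auto
qed

lemma nth_split4:
  assumes "i + 3 < length w"
  shows "w = take i w @ [w ! i, w ! (i + 1), w ! (i + 2), w ! (i + 3)] @ drop (i + 4) w"
proof -
  have "drop i w = w ! i # w ! (i + 1) # w ! (i + 2) # w ! (i + 3) # drop (i + 4) w"
    using assms by (simp add: Cons_nth_drop_Suc[symmetric] numeral_eq_Suc)
  then show ?thesis using append_take_drop_id[of i w] by simp
qed

text \<open>The index 0 stays outside the pairs because the first time of a word is not a middle
  time.\<close>

lemma sum_pairs_bound:
  fixes f :: "nat \<Rightarrow> real"
  assumes "0 \<le> f 0" "\<And>k. k < m \<Longrightarrow> K \<le> f (2 * k + 1) + f (2 * k + 2)"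
  shows "real m * K \<le> sum f {..<2 * m + 1}"
  using assms(2)
proof (induction m)
  case 0
  then show ?case using assms(1) by (simp add: lessThan_Suc)
next
  case (Suc m)
  have "real m * K \<le> sum f {..<2 * m + 1}" using Suc by simp
  moreover have "K \<le> f (2 * m + 1) + f (2 * m + 2)" using Suc.prems by simp
  ultimately show ?case by (simp add: algebra_simps)
qed

section \<open>Controllability and existence of optimal words\<close>

locale controls =
  fixes X Y :: quat and \<kappa> :: real
  assumes X: "X \<in> su2" "norm X = 1" and Y: "Y \<in> su2" "norm Y = 1"
    and \<kappa>: "0 < \<kappa>" "\<kappa> < X \<bullet> Y" and XY: "X \<bullet> Y < 1"
begin

sublocale xy: unit_pair X Y using X Y \<kappa> XY by unfold_locales auto
sublocale yx: unit_pair Y X using X Y \<kappa> XY by unfold_locales (auto simp: inner_commute)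

abbreviation "adm \<equiv> admissible X Y"
abbreviation "cst \<equiv> cost \<kappa> X"
abbreviation "opt \<equiv> optimal \<kappa> X Y"
abbreviation "gopt \<equiv> globally_optimal \<kappa> X Y"
text \<open>\<open>P\<close> and \<open>Q\<close> are the two coefficients of
  \<open>stationarity\<close> for the weights 1 of \<open>X\<close> and \<open>\<kappa>\<close> of
  \<open>Y\<close>.\<close>

abbreviation "P \<equiv> 1 - \<kappa> * (X \<bullet> Y)"
abbreviation "Q \<equiv> \<kappa> - X \<bullet> Y"

lemma X_neq_Y: "X \<noteq> Y" using XY X by (auto simp: norm_eq_1)

text \<open>The assumption \<open>\<kappa> < X \<bullet> Y\<close> makes \<open>P\<close> and
  \<open>Q\<close> have opposite signs; all sign arguments below rest on this.\<close>

lemma coefficients: "\<kappa> < 1" "0 < P" "Q < 0"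
proof -
  show "\<kappa> < 1" "Q < 0" using \<kappa> XY by auto
  have "\<kappa> * (X \<bullet> Y) < 1 * 1" using \<kappa> XY by (intro mult_strict_mono) auto
  then show "0 < P" by simp
qed

lemma exp_control_pi: "C \<in> {X, Y} \<Longrightarrow> exp (pi *\<^sub>R C) = - 1"
  using X Y by (auto intro!: exp_pi_imaginary_unit unit_su2_square)

lemma norm_word_val: "adm w \<Longrightarrow> norm (word_val w) = 1"
proof (induction w)
  case (Cons x w)
  then show ?case using X Y by (cases x) (auto simp: norm_quat_mult norm_exp_imaginary_unit)
qed simp

lemma cost_ge_total_time: "adm w \<Longrightarrow> \<kappa> * sum_list (map fst w) \<le> cst w"
proof (induction w)
  case (Cons x w)
  obtain t C where x: "x = (t, C)" by fastforce
  have "\<kappa> * t \<le> (if C = X then 1 else \<kappa>) * t"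
    using Cons.prems coefficients by (auto simp: x mult_left_le_one_le mult_right_mono)
  then show ?case using Cons by (simp add: x distrib_left)
qed simp

lemma cost_ge_time:
  assumes "adm w" "x \<in> set w"
  shows "\<kappa> * fst x \<le> cst w"
proof -
  have "fst x \<le> sum_list (map fst w)"
    using assms by (intro member_le_sum_list) (auto simp: admissible_iff)
  then have "\<kappa> * fst x \<le> \<kappa> * sum_list (map fst w)" using \<kappa> by simp
  with cost_ge_total_time[OF assms(1)] show ?thesis by simp
qed

text \<open>As \<open>\<kappa> > 0\<close>, a word not dearer than \<open>w0\<close> has all times
  at most \<open>cst w0 / \<kappa>\<close>, so the minimum is sought over a compact set of
  costs.\<close>

lemma optimal_exists:
  assumes w0: "adm w0" "length w0 \<le> N"
  shows "\<exists>w. opt N w \<and> word_val w = word_val w0"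
proof -
  let ?T = "cst w0 / \<kappa>" and ?g = "word_val w0"
  let ?S = "fst ` (attainable \<kappa> X Y ?T N \<inter> UNIV \<times> {?g})"
  have T: "fst x \<le> ?T" if "adm w" "cst w \<le> cst w0" "x \<in> set w" for w x
    using cost_ge_time[OF that(1,3)] that(2) \<kappa>(1) by (simp add: field_simps)
  have in_S: "cst w \<in> ?S" if "adm w" "length w \<le> N" "word_val w = ?g" "cst w \<le> cst w0" for w
    by (intro image_eqI[of _ _ "(cst w, ?g)"]) (use that T in \<open>auto simp: attainable_def\<close>)
  have "compact ?S"
    by (intro compact_continuous_image continuous_intros compact_Int_closed compact_attainable closed_Times)
  moreover have "?S \<noteq> {}" using in_S[of w0] w0 by blast
  ultimately obtain c where c: "c \<in> ?S" "\<And>c'. c' \<in> ?S \<Longrightarrow> c \<le> c'"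
    using compact_attains_inf by metis
  then obtain w where w: "adm w" "length w \<le> N" "word_val w = ?g" "cst w = c"
    by (auto simp: attainable_def)
  have "cst w \<le> cst v" if "adm v" "length v \<le> N" "word_val v = ?g" for v
    using c(2)[OF in_S[OF that]] c(2)[OF in_S[OF w0 refl order_refl]] w(4) by linarith
  then show ?thesis using w by (auto simp: optimal_def)
qed

text \<open>Negative times are not admissible, but exponentials of controls have period
  \<open>2 * pi\<close>, so \<open>2 * pi * k - t\<close> serves as \<open>- t\<close>;
  \<open>t \<le> k\<close> suffices because \<open>2 * pi \<ge> 1\<close>.\<close>

lemma inverse_word_exists:
  assumes "adm w"
  shows "\<exists>v. adm v \<and> word_val v * word_val w = 1 \<and> word_val w * word_val v = 1"
  using assms
proof (induction w)
  case Nil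
  then show ?case by (intro exI[of _ "[]"]) simp
next
  case (Cons x w)
  obtain t C where x: "x = (t, C)" by fastforce
  from Cons x obtain v where v: "adm v" "word_val v * word_val w = 1" "word_val w * word_val v = 1"
    by auto
  have C: "C \<in> {X, Y}" "t \<ge> 0" using Cons.prems by (auto simp: x)
  then have CC: "C * C = - 1" using X Y unit_su2_square by auto
  obtain k :: nat where k: "t \<le> real k" using real_arch_simple by blast
  define s where "s = 2 * pi * real k - t"
  have "real k * 1 \<le> real k * (2 * pi)" using pi_gt3 by (intro mult_left_mono) auto
  then have "s \<ge> 0" using k by (simp add: s_def mult_ac)
  have "exp ((s + t) *\<^sub>R C) = 1"
    unfolding exp_scaleR_imaginary_unit[OF CC] s_def
    using cos_int_2pin[of "int k"] sin_int_2pin[of "int k"] by simp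
  then have st: "exp (s *\<^sub>R C) * exp (t *\<^sub>R C) = 1" "exp (t *\<^sub>R C) * exp (s *\<^sub>R C) = 1"
    by (metis exp_scaleR_add, metis exp_scaleR_add add.commute)
  have "word_val v * exp (s *\<^sub>R C) * (exp (t *\<^sub>R C) * word_val w) = 1"
    by (metis st(1) v(2) mult.assoc mult_1_left)
  moreover have "exp (t *\<^sub>R C) * word_val w * (word_val v * exp (s *\<^sub>R C)) = 1"
    by (metis st(2) v(3) mult.assoc mult_1_left)
  ultimately show ?case using v C \<open>s \<ge> 0\<close>
    by (intro exI[of _ "v @ [(s, C)]"]) (auto simp: x)
qed

text \<open>Around one point \<open>h\<close> a ball of the sphere is reachable. Inverse words carry
  it isometrically to every reachable point with the same radius, and the sphere is
  connected.\<close>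

lemma controllable:
  assumes "norm g = 1"
  shows "\<exists>w. adm w \<and> word_val w = g"
proof -
  obtain e h where e: "e > 0" and h: "norm h = 1" and near: "\<And>g. norm g = 1 \<Longrightarrow> dist h g < e \<Longrightarrow>
      \<exists>a b c d. 0 < a \<and> 0 < b \<and> 0 < c \<and> 0 < d \<and>
      exp (a *\<^sub>R X) * exp (b *\<^sub>R Y) * exp (c *\<^sub>R X) * exp (d *\<^sub>R Y) = g"
    using xy.four_letters_locally_onto by blast
  have near': "\<exists>w. adm w \<and> word_val w = g" if "norm g = 1" "dist h g < e" for g
  proof -
    from near[OF that] obtain a b c d where "0 < a" "0 < b" "0 < c" "0 < d"
      "exp (a *\<^sub>R X) * exp (b *\<^sub>R Y) * exp (c *\<^sub>R X) * exp (d *\<^sub>R Y) = g" by blast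
    then show ?thesis
      by (intro exI[of _ "[(a, X), (b, Y), (c, X), (d, Y)]"]) (simp add: mult.assoc)
  qed
  obtain wh where wh: "adm wh" "word_val wh = h" using near'[OF h] e by auto
  obtain wi where wi: "adm wi" "word_val wi * h = 1" using inverse_word_exists[OF wh(1)] wh(2) by blast
  have step: "\<exists>w. adm w \<and> word_val w = y"
    if w: "adm w" "word_val w = x" and y: "norm y = 1" "dist x y < e" for w x y
  proof -
    obtain v where v: "adm v" "word_val v * x = 1" "x * word_val v = 1"
      using inverse_word_exists[OF w(1)] w(2) by blast
    \<comment> \<open>\<open>?z\<close> is \<open>y\<close> translated by the map that takes
      \<open>x\<close> to \<open>h\<close>; undoing the translation by the words for
      \<open>x\<close> and for the inverse of \<open>h\<close> gives a word for
      \<open>y\<close>.\<close>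
    let ?z = "h * word_val v * y"
    have "dist h ?z = norm (h * word_val v * (x - y))"
      by (simp add: dist_norm right_diff_distrib mult.assoc v)
    also have "\<dots> < e" using y h norm_word_val[OF v(1)] by (simp add: norm_quat_mult dist_norm)
    finally obtain u where u: "adm u" "word_val u = ?z"
      using near'[of ?z] y h norm_word_val[OF v(1)] by (auto simp: norm_quat_mult)
    have "word_val (w @ wi @ u) = x * (word_val wi * h) * word_val v * y"
      by (simp add: u w mult.assoc)
    also have "\<dots> = y" by (simp add: wi v)
    finally show ?thesis using w wi u by (intro exI[of _ "w @ wi @ u"]) auto
  qed
  show ?thesis
  proof (rule connected_induction_simple[where S = "sphere (0::quat) 1" and a = 1 and b = g])
    show "connected (sphere (0::quat) 1)" by (rule connected_sphere) (simp add: Basis_quat_def)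
    show "\<exists>w. adm w \<and> word_val w = 1" by (intro exI[of _ "[]"]) simp
    fix a :: quat assume a: "a \<in> sphere 0 1"
    have "dist x y < e" if "x \<in> ball a (e / 2)" "y \<in> ball a (e / 2)" for x y
      using that dist_triangle_half_l[of x a e y] by (simp add: dist_commute)
    then show "\<exists>T. openin (top_of_set (sphere 0 1)) T \<and> a \<in> T \<and>
        (\<forall>x\<in>T. \<forall>y\<in>T. (\<exists>w. adm w \<and> word_val w = x) \<longrightarrow> (\<exists>w. adm w \<and> word_val w = y))"
      using a e step by (intro exI[of _ "sphere 0 1 \<inter> ball a (e / 2)"]) (auto simp: openin_open_Int)
  qed (use assms in auto)
qed

section \<open>The relation between adjacent middle times and the length bound\<close>

abbreviation balanced :: "real \<Rightarrow> real \<Rightarrow> bool"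
  where "balanced tx ty \<equiv> P * sin ty * cos tx = Q * cos ty * sin tx"

text \<open>Otherwise \<open>improvable\<close> yields a cheaper word of the same length with the
  same value.\<close>

lemma balanced_XYXY:
  assumes "opt N (u @ [(a, X), (b, Y), (c, X), (d, Y)] @ v)"
    and pos: "0 < a" "0 < b" "b < pi" "0 < c" "c < pi" "0 < d"
  shows "balanced c b"
proof (rule ccontr)
  assume "\<not> balanced c b"
  then have "stationarity (X \<bullet> Y) 1 \<kappa> b c \<noteq> 0" by (simp add: stationarity_def)
  from xy.improvable[OF pos(1-5) less_imp_le[OF pos(6)] this] pos(6)
  obtain a' b' c' d' where "0 < a'" "0 < b'" "0 < c'" "0 < d'"
    "exp (a' *\<^sub>R X) * exp (b' *\<^sub>R Y) * exp (c' *\<^sub>R X) * exp (d' *\<^sub>R Y)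
      = exp (a *\<^sub>R X) * exp (b *\<^sub>R Y) * exp (c *\<^sub>R X) * exp (d *\<^sub>R Y)"
    "1 * (a' + c') + \<kappa> * (b' + d') < 1 * (a + c) + \<kappa> * (b + d)" by blast
  then show False
    using optimal_replace[OF assms(1), of "[(a', X), (b', Y), (c', X), (d', Y)]"] assms(1) X_neq_Y
    by (auto simp: optimal_def mult.assoc distrib_left)
qed

lemma balanced_YXYX:
  assumes "opt N (u @ [(a, Y), (b, X), (c, Y), (d, X)] @ v)"
    and pos: "0 < a" "0 < b" "b < pi" "0 < c" "c < pi" "0 < d"
  shows "balanced b c"
proof (rule ccontr)
  assume "\<not> balanced b c"
  then have "stationarity (Y \<bullet> X) \<kappa> 1 b c \<noteq> 0" by (simp add: stationarity_def inner_commute mult_ac)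
  from yx.improvable[OF pos(1-5) less_imp_le[OF pos(6)] this] pos(6)
  obtain a' b' c' d' where "0 < a'" "0 < b'" "0 < c'" "0 < d'"
    "exp (a' *\<^sub>R Y) * exp (b' *\<^sub>R X) * exp (c' *\<^sub>R Y) * exp (d' *\<^sub>R X)
      = exp (a *\<^sub>R Y) * exp (b *\<^sub>R X) * exp (c *\<^sub>R Y) * exp (d *\<^sub>R X)"
    "\<kappa> * (a' + c') + 1 * (b' + d') < \<kappa> * (a + c) + 1 * (b + d)" by blast
  then show False
    using optimal_replace[OF assms(1), of "[(a', Y), (b', X), (c', Y), (d', X)]"] assms(1) X_neq_Y
    by (auto simp: optimal_def mult.assoc distrib_left)
qed

text \<open>A smaller sum would make both angles acute; then the side with \<open>P\<close> is
  positive and the side with \<open>Q\<close> negative.\<close>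

lemma balanced_sum_ge:
  assumes "0 < s" "s < pi" "0 < t" "t < pi" "balanced s t"
  shows "pi / 2 \<le> s + t"
proof (rule ccontr)
  assume "\<not> pi / 2 \<le> s + t"
  then have "s < pi / 2" "t < pi / 2" using assms by linarith+
  then have "sin s > 0" "sin t > 0" "cos s > 0" "cos t > 0" using assms
    by (auto intro!: sin_gt_zero cos_gt_zero)
  then have "P * sin t * cos s > 0" "Q * cos t * sin s < 0"
    using coefficients by (auto simp: mult_pos_pos mult_neg_pos)
  with assms(5) show False by linarith
qed

lemma reduced_alternates:
  assumes "adm w" "reduced_word w" "Suc i < length w"
  shows "snd (w ! i) = X \<longleftrightarrow> snd (w ! Suc i) = Y" "snd (w ! i) = Y \<longleftrightarrow> snd (w ! Suc i) = X"
proof -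
  have "snd (w ! i) \<in> {X, Y}" "snd (w ! Suc i) \<in> {X, Y}" "snd (w ! i) \<noteq> snd (w ! Suc i)"
    using assms by (auto simp: admissible_iff reduced_word_iff successively_conv_nth)
  then show "snd (w ! i) = X \<longleftrightarrow> snd (w ! Suc i) = Y" "snd (w ! i) = Y \<longleftrightarrow> snd (w ! Suc i) = X"
    using X_neq_Y by auto
qed

lemma balanced_nth:
  assumes w: "opt N w" "reduced_word w" and i: "i + 3 < length w"
    and lt: "fst (w ! (i + 1)) < pi" "fst (w ! (i + 2)) < pi"
  shows "snd (w ! (i + 1)) = X \<Longrightarrow> balanced (fst (w ! (i + 1))) (fst (w ! (i + 2)))"
    and "snd (w ! (i + 1)) = Y \<Longrightarrow> balanced (fst (w ! (i + 2))) (fst (w ! (i + 1)))"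
proof -
  have adm: "adm w" using w(1) by (simp add: optimal_def)
  have pos: "0 < fst (w ! i)" "0 < fst (w ! (i + 1))" "0 < fst (w ! (i + 2))" "0 < fst (w ! (i + 3))"
    using w(2) i by (auto simp: reduced_word_iff)
  note alt = reduced_alternates[OF adm w(2), of i] reduced_alternates[OF adm w(2), of "i + 1"]
    reduced_alternates[OF adm w(2), of "i + 2"]
  show "balanced (fst (w ! (i + 1))) (fst (w ! (i + 2)))" if "snd (w ! (i + 1)) = X"
  proof -
    have "snd (w ! i) = Y" "snd (w ! (i + 2)) = Y" "snd (w ! (i + 3)) = X"
      using alt i that by (auto simp: eval_nat_numeral)
    with that have "w ! i = (fst (w ! i), Y)" "w ! (i + 1) = (fst (w ! (i + 1)), X)"
      "w ! (i + 2) = (fst (w ! (i + 2)), Y)" "w ! (i + 3) = (fst (w ! (i + 3)), X)"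
      by (simp_all add: prod_eq_iff)
    then have "take i w @ [(fst (w ! i), Y), (fst (w ! (i + 1)), X), (fst (w ! (i + 2)), Y),
        (fst (w ! (i + 3)), X)] @ drop (i + 4) w = w"
      using nth_split4[OF i] by argo
    with w(1) have "opt N (take i w @ [(fst (w ! i), Y), (fst (w ! (i + 1)), X), (fst (w ! (i + 2)), Y),
        (fst (w ! (i + 3)), X)] @ drop (i + 4) w)" by (simp only:)
    from balanced_YXYX[OF this pos(1,2) lt(1) pos(3) lt(2) pos(4)] show ?thesis .
  qed
  show "balanced (fst (w ! (i + 2))) (fst (w ! (i + 1)))" if "snd (w ! (i + 1)) = Y"
  proof -
    have "snd (w ! i) = X" "snd (w ! (i + 2)) = X" "snd (w ! (i + 3)) = Y"
      using alt i that by (auto simp: eval_nat_numeral)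
    with that have "w ! i = (fst (w ! i), X)" "w ! (i + 1) = (fst (w ! (i + 1)), Y)"
      "w ! (i + 2) = (fst (w ! (i + 2)), X)" "w ! (i + 3) = (fst (w ! (i + 3)), Y)"
      by (simp_all add: prod_eq_iff)
    then have "take i w @ [(fst (w ! i), X), (fst (w ! (i + 1)), Y), (fst (w ! (i + 2)), X),
        (fst (w ! (i + 3)), Y)] @ drop (i + 4) w = w"
      using nth_split4[OF i] by argo
    with w(1) have "opt N (take i w @ [(fst (w ! i), X), (fst (w ! (i + 1)), Y), (fst (w ! (i + 2)), X),
        (fst (w ! (i + 3)), Y)] @ drop (i + 4) w)" by (simp only:)
    from balanced_XYXY[OF this pos(1,2) lt(1) pos(3) lt(2) pos(4)] show ?thesis .
  qed
qed

lemma middle_pair_ge: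
  assumes "opt N w" "reduced_word w" "i + 3 < length w"
  shows "pi / 2 \<le> fst (w ! (i + 1)) + fst (w ! (i + 2))"
proof -
  have adm: "adm w" using assms(1) by (simp add: optimal_def)
  have pos: "0 < fst (w ! (i + 1))" "0 < fst (w ! (i + 2))"
    using assms(2,3) by (auto simp: reduced_word_iff)
  show ?thesis
  proof (cases "fst (w ! (i + 1)) < pi \<and> fst (w ! (i + 2)) < pi")
    case True
    have "snd (w ! (i + 1)) \<in> {X, Y}" using adm assms(3) by (auto simp: admissible_iff)
    then show ?thesis
      using balanced_nth[OF assms] balanced_sum_ge True pos by (metis add.commute insertE singletonD)
  next
    \<comment> \<open>A single time \<open>\<ge> pi\<close> already exceeds the bound.\<close>
    case False
    then show ?thesis using pos pi_gt_zero by linarith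
  qed
qed

text \<open>The bound does not depend on \<open>N\<close>, so that the minimum over the words of length at most
  \<open>N\<close> is the same for all large \<open>N\<close>.\<close>

lemma optimal_length_bound:
  assumes w: "opt N w" "reduced_word w" and c: "cst w \<le> c"
  shows "length w \<le> 2 * nat \<lceil>c / (\<kappa> * (pi / 2))\<rceil> + 3"
proof (cases "length w \<le> 3")
  case False
  \<comment> \<open>Number of disjoint pairs among the \<open>length w - 2\<close> middle times.
    Each pair costs at least \<open>\<kappa> * (pi / 2)\<close>; the two ends and a possible
    unpaired letter account for the 3.\<close>
  define m where "m = (length w - 2) div 2"
  have m: "2 * m + 2 \<le> length w" "length w \<le> 2 * m + 3" using False by (auto simp: m_def)
  have adm: "adm w" using w(1) by (simp add: optimal_def)
  let ?f = "\<lambda>i. fst (w ! i)"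
  have nonneg: "0 \<le> ?f i" if "i < length w" for i using that adm by (auto simp: admissible_iff)
  have "real m * (pi / 2) \<le> sum ?f {..<2 * m + 1}"
  proof (rule sum_pairs_bound)
    show "0 \<le> ?f 0" using m by (intro nonneg) linarith
    show "pi / 2 \<le> ?f (2 * k + 1) + ?f (2 * k + 2)" if "k < m" for k
      using middle_pair_ge[OF w, of "2 * k"] m that by simp
  qed
  also have "\<dots> \<le> sum ?f {..<length w}" using m nonneg by (intro sum_mono2) auto
  also have "\<dots> = sum_list (map fst w)" by (simp add: sum_list_sum_nth atLeast0LessThan)
  finally have "\<kappa> * (real m * (pi / 2)) \<le> \<kappa> * sum_list (map fst w)" using \<kappa>(1) by simp
  also have "\<dots> \<le> c" using cost_ge_total_time[OF adm] c by linarith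
  finally have "real m \<le> c / (\<kappa> * (pi / 2))" using \<kappa>(1) by (simp add: field_simps)
  then have "m \<le> nat \<lceil>c / (\<kappa> * (pi / 2))\<rceil>" by linarith
  with m show ?thesis by linarith
qed simp

text \<open>A minimizer \<open>w\<close> among the words of length at most \<open>N\<close> also
  beats a longer word \<open>v\<close>: the minimum over the words up to the length of
  \<open>v\<close> is attained by a reduced word, whose length is again at most
  \<open>N\<close>.\<close>

lemma globally_optimal_exists:
  assumes "norm g = 1"
  shows "\<exists>w. gopt w \<and> word_val w = g"
proof -
  obtain w0 where w0: "adm w0" "word_val w0 = g" using controllable[OF assms] by blast
  define N where "N = max (length w0) (2 * nat \<lceil>cst w0 / (\<kappa> * (pi / 2))\<rceil> + 3)"
  have short: "\<exists>w. opt M w \<and> word_val w = g \<and> length w \<le> N" if len: "length w0 \<le> M" for M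
  proof -
    obtain v where v: "opt M v" "word_val v = g" using optimal_exists[OF w0(1) len] w0(2) by auto
    then obtain w where w: "adm w" "reduced_word w" "word_val w = word_val v" "cst w = cst v" "length w \<le> length v"
      using reduced_word_exists[of X Y v] by (auto simp: optimal_def)
    then have "opt M w" using v by (simp add: optimal_def)
    moreover have "cst w \<le> cst w0" using v w w0 len by (simp add: optimal_def)
    ultimately have "length w \<le> N" using optimal_length_bound[of M w "cst w0"] w(2) by (simp add: N_def)
    with \<open>opt M w\<close> w(3) v(2) show ?thesis by blast
  qed
  have "length w0 \<le> N" by (simp add: N_def)
  from short[OF this] obtain w where w: "opt N w" "word_val w = g" by blast
  have "cst w \<le> cst v" if v: "adm v" "word_val v = g" for v
  proof -
    obtain u where u: "opt (max N (length v)) u" "word_val u = g" "length u \<le> N"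
      using short[OF max.coboundedI1[OF \<open>length w0 \<le> N\<close>], of "length v"] by blast
    have "cst w \<le> cst u" using w u by (simp add: optimal_def)
    also have "\<dots> \<le> cst v" using u v by (simp add: optimal_def)
    finally show ?thesis .
  qed
  with w show ?thesis by (auto simp: globally_optimal_def optimal_def)
qed

section \<open>Structure of optimal words\<close>

lemma exp_control_minus_pi: "C \<in> {X, Y} \<Longrightarrow> exp ((t - pi) *\<^sub>R C) = - exp (t *\<^sub>R C)"
  using exp_scaleR_add[of "t - pi" pi C] exp_control_pi[of C] by simp

text \<open>Trading \<open>pi\<close> units of \<open>X\<close> for \<open>pi\<close> units of
  \<open>Y\<close> preserves the value and changes the cost by
  \<open>(\<kappa> - 1) * pi < 0\<close>.\<close>

lemma globally_optimal_X_lt_pi: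
  assumes "gopt w" "(t, X) \<in> set w"
  shows "t < pi"
proof (rule ccontr)
  assume "\<not> t < pi"
  obtain u v where w: "w = u @ [(t, X)] @ v" using split_list[OF assms(2)] by auto
  have "cst [(t, X)] \<le> cst [(t - pi, X), (pi, Y)]"
    by (rule globally_optimal_replace[OF assms(1)[unfolded w]])
      (use \<open>\<not> t < pi\<close> in \<open>simp_all add: exp_control_minus_pi exp_control_pi\<close>)
  then have "pi \<le> \<kappa> * pi" using X_neq_Y by simp
  with coefficients(1) show False by simp
qed

text \<open>The competing word has five letters in place of three, so optimality among all lengths
  enters here.\<close>

lemma globally_optimal_middle_Y_ge:
  assumes w: "gopt (u @ [(a, X), (b, Y), (c, X)] @ v)" and pos: "0 < a" "0 < b" "0 < c"
  shows "pi / 2 \<le> b"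
proof (rule ccontr)
  assume "\<not> pi / 2 \<le> b"
  then have b: "b < pi / 2" "b < pi" using pi_gt_zero by linarith+
  \<comment> \<open>The letter \<open>Y\<close> of time 0 is inserted after time \<open>c1\<close>
    of the last \<open>X\<close>. Cutting at \<open>pi / 2\<close> ensures
    \<open>cos c1 \<ge> 0\<close>, so that \<open>stationarity\<close> is positive; the rest
    \<open>c - c1\<close> may be 0.\<close>
  define c1 where "c1 = min c (pi / 2)"
  have c1: "0 < c1" "c1 < pi" "c1 \<le> c" "c1 \<le> pi / 2" using pos b pi_gt_zero unfolding c1_def by linarith+
  have trig: "sin b > 0" "cos b > 0" "sin c1 > 0" "cos c1 \<ge> 0"
    using b c1 pos by (auto intro!: sin_gt_zero cos_gt_zero cos_ge_zero)
  have "stationarity (X \<bullet> Y) 1 \<kappa> b c1 = P * sin b * cos c1 + (- Q) * cos b * sin c1"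
    by (simp add: stationarity_def algebra_simps)
  also have "\<dots> > 0" using trig coefficients by (intro add_nonneg_pos mult_nonneg_nonneg mult_pos_pos) auto
  finally have s: "stationarity (X \<bullet> Y) 1 \<kappa> b c1 > 0" .
  have "stationarity (X \<bullet> Y) 1 \<kappa> b c1 * cos b > 0" using s trig by simp
  from xy.improvable[OF pos(1,2) b(2) c1(1,2) order_refl less_imp_neq[OF s, symmetric] this]
  obtain a' b' c' d' where n: "0 < a'" "0 < b'" "0 < c'" "0 < d'" and
    eq: "exp (a' *\<^sub>R X) * exp (b' *\<^sub>R Y) * exp (c' *\<^sub>R X) * exp (d' *\<^sub>R Y)
      = exp (a *\<^sub>R X) * exp (b *\<^sub>R Y) * exp (c1 *\<^sub>R X) * exp (0 *\<^sub>R Y)" and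
    less: "1 * (a' + c') + \<kappa> * (b' + d') < 1 * (a + c1) + \<kappa> * (b + 0)" by blast
  have "exp (a *\<^sub>R X) * exp (b *\<^sub>R Y) * exp (c *\<^sub>R X)
      = exp (a *\<^sub>R X) * exp (b *\<^sub>R Y) * exp (c1 *\<^sub>R X) * exp (0 *\<^sub>R Y) * exp ((c - c1) *\<^sub>R X)"
    using exp_scaleR_add[of c1 "c - c1" X] by (simp add: mult.assoc)
  then have eq': "word_val [(a', X), (b', Y), (c', X), (d', Y), (c - c1, X)] = word_val [(a, X), (b, Y), (c, X)]"
    using arg_cong[OF eq, of "\<lambda>q. q * exp ((c - c1) *\<^sub>R X)"] by (simp add: mult.assoc)
  have "cst [(a, X), (b, Y), (c, X)] \<le> cst [(a', X), (b', Y), (c', X), (d', Y), (c - c1, X)]"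
    by (rule globally_optimal_replace[OF w _ eq']) (use n c1 in simp)
  with less show False using X_neq_Y by (simp add: distrib_left)
qed

lemma remove_pi:
  assumes "adm w" "(t, Y) \<in> set w" "pi \<le> t"
  shows "\<exists>v. adm v \<and> word_val v = - word_val w \<and> cst v = cst w - \<kappa> * pi"
proof -
  obtain u v where w: "w = u @ [(t, Y)] @ v" using split_list[OF assms(2)] by auto
  show ?thesis using assms X_neq_Y
    by (intro exI[of _ "u @ [(t - pi, Y)] @ v"])
      (auto simp: w exp_control_minus_pi right_diff_distrib)
qed

text \<open>Since \<open>exp (pi Y) = - 1\<close> is central, a factor \<open>exp (pi Y)\<close> can be moved to the front.\<close>

lemma normalized_optimal_exists:
  assumes "norm g = 1"
  shows "\<exists>w. gopt w \<and> reduced_word w \<and> word_val w = g \<and>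
    (\<forall>i<length w. pi \<le> fst (w ! i) \<longrightarrow> i = 0 \<and> snd (w ! i) = Y)"
proof -
  have reduced: "\<exists>w. gopt w \<and> reduced_word w \<and> word_val w = g" if "norm g = 1" for g
  proof -
    obtain v where v: "gopt v" "word_val v = g" using globally_optimal_exists[OF \<open>norm g = 1\<close>] by blast
    then obtain w where "adm w" "reduced_word w" "word_val w = word_val v" "cst w = cst v"
      using reduced_word_exists[of X Y v] by (auto simp: globally_optimal_def)
    with v show ?thesis by (auto simp: globally_optimal_def)
  qed
  obtain w where w: "gopt w" "reduced_word w" "word_val w = g" using reduced[OF assms] by blast
  have Y_if_ge: "snd x = Y" if "gopt v" "x \<in> set v" "pi \<le> fst x" for v x
    using globally_optimal_X_lt_pi[OF that(1), of "fst x"] that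
    by (cases x) (auto simp: globally_optimal_def admissible_iff)
  show ?thesis
  proof (cases "\<forall>x\<in>set w. fst x < pi")
    case True
    then show ?thesis using w by (intro exI[of _ w]) (auto simp: not_le[symmetric])
  next
    case False
    then obtain t where t: "(t, Y) \<in> set w" "pi \<le> t" using Y_if_ge[OF w(1)] by (metis not_le prod.collapse)
    then obtain w1 where w1: "adm w1" "word_val w1 = - g" "cst w1 = cst w - \<kappa> * pi"
      using remove_pi[of w t] w by (auto simp: globally_optimal_def)
    have "norm (- g) = 1" using assms by simp
    from reduced[OF this] obtain v where v: "gopt v" "reduced_word v" "word_val v = - g" by blast
    have "adm v" using v(1) by (simp add: globally_optimal_def)
    have cv: "cst v \<le> cst w - \<kappa> * pi" using v w1 by (auto simp: globally_optimal_def)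
    \<comment> \<open>If \<open>v\<close> also had a time \<open>\<ge> pi\<close>, removing
      \<open>pi\<close> again would give a word for \<open>g\<close> of cost at most
      \<open>cst w - 2 * (\<kappa> * pi)\<close>.\<close>
    have lt: "fst x < pi" if "x \<in> set v" for x
    proof (rule ccontr)
      assume "\<not> fst x < pi"
      then have "(fst x, Y) \<in> set v" "pi \<le> fst x" using Y_if_ge[OF v(1) that] that by (metis not_le prod.collapse)+
      from remove_pi[OF \<open>adm v\<close> this] obtain w' where "adm w'" "word_val w' = g" "cst w' = cst v - \<kappa> * pi"
        using v(3) by auto
      then have "cst w \<le> cst v - \<kappa> * pi" using w by (auto simp: globally_optimal_def)
      with cv \<kappa>(1) pi_gt_zero show False by (smt (verit) mult_pos_pos)
    qed
    \<comment> \<open>The removed \<open>pi\<close> of \<open>Y\<close> is put in front and merged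
      with a leading \<open>Y\<close>, which keeps the word reduced. By \<open>cv\<close> the cost
      does not exceed that of \<open>w\<close>.\<close>
    define u where "u = (case v of (d, C) # v' \<Rightarrow> if C = Y then (d + pi, Y) # v' else (pi, Y) # v | [] \<Rightarrow> (pi, Y) # v)"
    have eY: "exp ((d + pi) *\<^sub>R Y) = - exp (d *\<^sub>R Y)" for d
      using exp_scaleR_add[of d pi Y] exp_control_pi[of Y] by simp
    have g: "g = - word_val v" using v(3) by simp
    have u: "adm u" "word_val u = g" "cst u = cst v + \<kappa> * pi"
      using \<open>adm v\<close> X_neq_Y pi_gt_zero unfolding u_def g
      by (auto split: list.split prod.split simp: eY exp_control_pi distrib_left)
    have "reduced_word u"
    proof (cases v)
      case Nil
      then show ?thesis by (simp add: u_def reduced_word_iff)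
    next
      case (Cons x v')
      then show ?thesis using v(2)
        by (cases x) (auto simp: u_def reduced_word_iff successively_Cons add_pos_pos)
    qed
    have "fst (u ! i) < pi" if "i < length u" "i \<noteq> 0" for i
    proof -
      obtain j where j: "i = Suc j" using \<open>i \<noteq> 0\<close> not0_implies_Suc by blast
      have "set (tl u) \<subseteq> set v" unfolding u_def by (auto split: list.split prod.split)
      moreover have "u ! i \<in> set (tl u)" using that by (cases u) (auto simp: j)
      ultimately have "u ! i \<in> set v" by blast
      then show ?thesis by (rule lt)
    qed
    moreover have "gopt u" using w u cv unfolding globally_optimal_def by auto
    ultimately show ?thesis
      using u \<open>reduced_word u\<close> Y_if_ge[of u] by (intro exI[of _ u]) (metis not_le nth_mem)
  qed
qed

section \<open>Propagation of the relation along all middle times\<close>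

text \<open>The relation between adjacent middle parameters says that this quantity is the same for both.\<close>

definition scaled_cot :: "cword \<Rightarrow> nat \<Rightarrow> real"
  where "scaled_cot w i = (if snd (w ! i) = X then P else Q) * cot (fst (w ! i))"

lemma balanced_iff_cot:
  assumes "0 < s" "s < pi" "0 < t" "t < pi"
  shows "balanced s t \<longleftrightarrow> P * cot s = Q * cot t"
proof -
  have "sin s > 0" "sin t > 0" using assms by (simp_all add: sin_gt_zero)
  then have "p * cot s = q * cot t \<longleftrightarrow> p * sin t * cos s = q * cos t * sin s" for p q
    by (simp add: cot_def frac_eq_eq mult_ac)
  then show ?thesis by blast
qed

lemma cot_inj_0_pi:
  assumes "0 < s" "s < pi" "0 < t" "t < pi" "cot s = cot t"
  shows "s = (t :: real)"
proof -
  have "sin s > 0" "sin t > 0" using assms by (simp_all add: sin_gt_zero)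
  then have "sin s * cos t = cos s * sin t" using assms(5) by (simp add: cot_def frac_eq_eq mult.commute)
  then have "sin (s - t) = 0" by (simp add: sin_diff)
  then have "s - t = 0" by (rule sin_eq_0_pi[rotated 2]) (use assms in auto)
  then show ?thesis by simp
qed

text \<open>Two adjacent middle letters are the inner ones of four consecutive letters, hence
  balanced. The list index 1 is the first middle position.\<close>

lemma scaled_cot_constant:
  assumes w: "gopt w" "reduced_word w" and lt: "\<And>i. 0 < i \<Longrightarrow> i < length w \<Longrightarrow> fst (w ! i) < pi"
    and i: "0 < i" "i + 1 < length w"
  shows "scaled_cot w i = scaled_cot w 1"
  using i
proof (induction i)
  case (Suc i)
  show ?case
  proof (cases "i = 0")
    case False
    have opt: "opt (length w) w" using w(1) by (rule globally_optimal_imp_optimal) simp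
    have adm: "adm w" using w(1) by (simp add: globally_optimal_def)
    obtain j where j: "i = Suc j" using False not0_implies_Suc by blast
    have len: "j + 3 < length w" using Suc.prems by (simp add: j)
    have t: "0 < fst (w ! i)" "fst (w ! i) < pi" "0 < fst (w ! Suc i)" "fst (w ! Suc i) < pi"
      using w(2) lt[of i] lt[of "Suc i"] len by (auto simp: reduced_word_iff j)
    have C: "snd (w ! i) \<in> {X, Y}" using adm len by (auto simp: admissible_iff j)
    have alt: "snd (w ! Suc i) = X \<longleftrightarrow> snd (w ! i) = Y"
      using reduced_alternates[OF adm w(2), of i] len by (auto simp: j)
    note bal = balanced_nth[OF opt w(2) len]
    have "scaled_cot w (Suc i) = scaled_cot w i"
    proof (cases "snd (w ! i) = X")
      case True
      then have "balanced (fst (w ! i)) (fst (w ! Suc i))" using bal(1) t by (simp add: j)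
      then show ?thesis using True alt X_neq_Y t by (simp add: scaled_cot_def balanced_iff_cot)
    next
      case False
      then have "balanced (fst (w ! Suc i)) (fst (w ! i))" using bal(2) t C by (simp add: j)
      then show ?thesis using False C alt t by (simp add: scaled_cot_def balanced_iff_cot)
    qed
    with Suc False show ?thesis by simp
  qed simp
qed simp

lemma middle_Y_ge:
  assumes w: "gopt w" "reduced_word w" and i: "0 < i" "i + 1 < length w" "snd (w ! i) = Y"
  shows "pi / 2 \<le> fst (w ! i)"
proof -
  obtain j where j: "i = Suc j" using i(1) gr0_conv_Suc by blast
  have adm: "adm w" using w(1) by (simp add: globally_optimal_def)
  have len: "j + 2 < length w" using i by (simp add: j)
  have "snd (w ! j) = X" "snd (w ! Suc (Suc j)) = X"
    using reduced_alternates[OF adm w(2), of j] reduced_alternates[OF adm w(2), of "Suc j"] i len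
    by (auto simp: j)
  then have "[w ! j, w ! Suc j, w ! Suc (Suc j)]
      = [(fst (w ! j), X), (fst (w ! i), Y), (fst (w ! Suc (Suc j)), X)]"
    using i(3) by (simp add: prod_eq_iff j)
  moreover have "take j w @ [w ! j, w ! Suc j, w ! Suc (Suc j)] @ drop (j + 3) w = w"
  proof -
    have "drop j w = w ! j # w ! Suc j # w ! Suc (Suc j) # drop (j + 3) w"
      using len by (simp add: Cons_nth_drop_Suc[symmetric] numeral_eq_Suc)
    then show ?thesis using append_take_drop_id[of j w] by simp
  qed
  ultimately have "gopt (take j w @ [(fst (w ! j), X), (fst (w ! i), Y), (fst (w ! Suc (Suc j)), X)] @ drop (j + 3) w)"
    using w(1) by (simp only:)
  then show ?thesis
    by (rule globally_optimal_middle_Y_ge) (use w(2) len in \<open>auto simp: reduced_word_iff j\<close>)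
qed

text \<open>The common value of \<open>scaled_cot\<close> extends the relation from neighbours to
  arbitrary pairs of middle letters.\<close>

lemma middle_balanced:
  assumes w: "gopt w" "reduced_word w" and lt: "\<And>i. 0 < i \<Longrightarrow> i < length w \<Longrightarrow> fst (w ! i) < pi"
    and i: "0 < i" "i + 1 < length w" "snd (w ! i) = X" and j: "0 < j" "j + 1 < length w" "snd (w ! j) = Y"
  shows "balanced (fst (w ! i)) (fst (w ! j))"
proof -
  have "scaled_cot w i = scaled_cot w j" using scaled_cot_constant[OF w lt i(1,2)] scaled_cot_constant[OF w lt j(1,2)] by simp
  then show ?thesis
    using i j X_neq_Y lt[of i] lt[of j] w(2) by (simp add: scaled_cot_def reduced_word_iff balanced_iff_cot)
qed

lemma middle_X_le:
  assumes w: "gopt w" "reduced_word w" and lt: "\<And>i. 0 < i \<Longrightarrow> i < length w \<Longrightarrow> fst (w ! i) < pi"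
    and n: "4 \<le> length w" and i: "0 < i" "i + 1 < length w" "snd (w ! i) = X"
  shows "fst (w ! i) \<le> pi / 2"
proof (rule ccontr)
  let ?s = "fst (w ! i)"
  assume s: "\<not> ?s \<le> pi / 2"
  have adm: "adm w" using w(1) by (simp add: globally_optimal_def)
  \<comment> \<open>With at least four letters some neighbour of the middle letter \<open>X\<close>
    is itself middle, and it is a \<open>Y\<close>: the next one for the first middle position, the
    previous one otherwise.\<close>
  obtain j where j: "0 < j" "j + 1 < length w" "snd (w ! j) = Y"
  proof (cases "i = 1")
    case True
    then show ?thesis using that[of 2] reduced_alternates(1)[OF adm w(2), of 1] i n by (simp add: numeral_2_eq_2)
  next
    case False
    then obtain k where "i = Suc k" "0 < k" using i(1) by (metis One_nat_def gr0_conv_Suc not_gr_zero)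
    then show ?thesis using that[of k] reduced_alternates(2)[OF adm w(2), of k] i by simp
  qed
  let ?t = "fst (w ! j)"
  have t: "pi / 2 \<le> ?t" "?t < pi" using middle_Y_ge[OF w j] lt j by auto
  have "?s < pi" using lt i by simp
  \<comment> \<open>As the time of \<open>Y\<close> is at least \<open>pi / 2\<close>, the side with
    \<open>Q\<close> is nonnegative, while an obtuse time of \<open>X\<close> makes the side with
    \<open>P\<close> negative.\<close>
  have "sin ?t > 0" "sin ?s > 0" using t s \<open>?s < pi\<close> pi_gt_zero by (auto intro!: sin_gt_zero)
  moreover have "cos ?t \<le> 0" "cos ?s < 0"
    using cos_monotone_0_pi_le[of "pi / 2" ?t] cos_monotone_0_pi[of "pi / 2" ?s] t s \<open>?s < pi\<close> by auto
  ultimately have "P * sin ?t * cos ?s < 0" "0 \<le> Q * cos ?t * sin ?s"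
    using coefficients by (simp_all add: mult_pos_neg mult_nonneg_nonneg mult_nonpos_nonpos)
  with middle_balanced[OF w lt i j] show False by simp
qed

text \<open>Letters at distance two have the same control and hence the same nonzero coefficient in
  \<open>scaled_cot\<close>; the cotangent is injective on the interval from 0 to
  \<open>pi\<close>.\<close>

lemma middle_period_two:
  assumes w: "gopt w" "reduced_word w" and lt: "\<And>i. 0 < i \<Longrightarrow> i < length w \<Longrightarrow> fst (w ! i) < pi"
    and i: "0 < i" "i + 3 < length w"
  shows "fst (w ! i) = fst (w ! (i + 2))"
proof -
  have adm: "adm w" using w(1) by (simp add: globally_optimal_def)
  have X_iff: "snd (w ! (i + 2)) = X \<longleftrightarrow> snd (w ! i) = X"
    using reduced_alternates(1)[OF adm w(2), of i] reduced_alternates(2)[OF adm w(2), of "Suc i"] i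
    unfolding add_2_eq_Suc' by linarith
  define c where "c = (if snd (w ! i) = X then P else Q)"
  have "c \<noteq> 0" using coefficients by (simp add: c_def)
  have "scaled_cot w i = scaled_cot w (i + 2)"
    using scaled_cot_constant[OF w lt, of i] scaled_cot_constant[OF w lt, of "i + 2"] i by simp
  then have "c * cot (fst (w ! i)) = c * cot (fst (w ! (i + 2)))"
    by (simp only: scaled_cot_def c_def X_iff)
  with \<open>c \<noteq> 0\<close> have "cot (fst (w ! i)) = cot (fst (w ! (i + 2)))" by simp
  then show ?thesis
    by (rule cot_inj_0_pi[rotated 4]) (use lt[of i] lt[of "i + 2"] w(2) i in \<open>auto simp: reduced_word_iff\<close>)
qed

end

section \<open>Assembly: from list indices to word positions\<close>

theorem theorem2p11:
  fixes X Y g :: quat and \<alpha> \<kappa> :: real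
  assumes "X \<in> su2" and "norm X = 1"
    and "Y \<in> su2" and "norm Y = 1"
    and "0 < \<alpha>" and "\<alpha> < pi" and "X \<bullet> Y = cos \<alpha>"
    and "0 \<le> \<kappa>" and "\<kappa> \<le> 1"
    and "0 < \<kappa>" and "\<kappa> < cos \<alpha>"
    and "g \<in> SU2"
  shows "\<exists>n w. n_optimal \<kappa> X Y n w \<and> reduced_word w
    \<and> word_val w = g \<and> cost \<kappa> X w = inf_cost \<kappa> X Y g
    \<and> pi_condition Y w
    \<and> (\<forall>p. 2 \<le> p \<and> p + 3 \<le> n \<longrightarrow> time w p = time w (p + 2))
    \<and> (\<forall>p\<in>middle w. control w p = Y \<longrightarrow> pi / 2 \<le> time w p \<and> time w p < pi)
    \<and> (4 \<le> n \<longrightarrow>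
        (\<forall>p\<in>middle w. control w p = X \<longrightarrow> 0 < time w p \<and> time w p \<le> pi / 2) \<and>
        (\<forall>p\<in>middle w. \<forall>q\<in>middle w. control w p = X \<and> control w q = Y \<longrightarrow>
          (1 - \<kappa> * cos \<alpha>) * sin (time w q) * cos (time w p)
            = (\<kappa> - cos \<alpha>) * cos (time w q) * sin (time w p)))"
proof -
  have "cos \<alpha> < 1" using assms cos_monotone_0_pi[of 0 \<alpha>] by simp
  with assms interpret controls X Y \<kappa> by unfold_locales auto
  obtain w where w: "gopt w" "reduced_word w" and val: "word_val w = g"
    and ge: "\<And>i. i < length w \<Longrightarrow> pi \<le> fst (w ! i) \<Longrightarrow> i = 0 \<and> snd (w ! i) = Y"
    using normalized_optimal_exists[of g] assms by (auto simp: SU2_def)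
  have lt: "fst (w ! i) < pi" if "0 < i" "i < length w" for i using ge[of i] that by force
  have pos: "0 < fst (w ! i)" if "i < length w" for i using w(2) that by (simp add: reduced_word_iff)
  \<comment> \<open>Positions count from 1 and list indices from 0, so a middle position
    \<open>p\<close> becomes an index \<open>p - 1\<close> that is neither first nor last.\<close>
  have mid: "0 < p - 1" "p - 1 + 1 < length w" "p - 1 < length w" if "p \<in> middle w" for p
    using that by (auto simp: middle_def)
  have "n_optimal \<kappa> X Y (length w) w" using w(1) by (simp add: n_optimal_def globally_optimal_def)
  moreover have "cost \<kappa> X w = inf_cost \<kappa> X Y g"
    unfolding inf_cost_def
    by (rule cInf_eq_minimum[symmetric]) (use w(1) val in \<open>auto simp: globally_optimal_def\<close>)
  moreover have "pi_condition Y w"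
  proof -
    \<comment> \<open>Only the first letter can reach \<open>pi\<close>, which gives both the count
      and the exclusion of middle positions.\<close>
    have at_1: "p = 1 \<and> control w p = Y" if "p \<in> {1..length w}" "pi \<le> time w p" for p
    proof -
      have "p - 1 < length w" using that(1) by auto
      with ge[OF this] that show ?thesis by (auto simp: time_def control_def)
    qed
    then have "{p \<in> {1..length w}. pi \<le> time w p} \<subseteq> {1}" by blast
    from card_mono[OF _ this] have "card {p \<in> {1..length w}. pi \<le> time w p} \<le> 1" by simp
    moreover have "1 \<notin> middle w" by (simp add: middle_def)
    ultimately show ?thesis unfolding pi_condition_def using at_1 by metis
  qed
  moreover have "time w p = time w (p + 2)" if "2 \<le> p \<and> p + 3 \<le> length w" for p
    using middle_period_two[OF w lt, of "p - 1"] that by (simp add: time_def)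
  moreover have "pi / 2 \<le> time w p \<and> time w p < pi" if "p \<in> middle w" "control w p = Y" for p
    using middle_Y_ge[OF w mid(1,2)[OF that(1)]] lt[OF mid(1,3)[OF that(1)]] that(2)
    unfolding time_def control_def by blast
  moreover have "0 < time w p \<and> time w p \<le> pi / 2"
    if "4 \<le> length w" "p \<in> middle w" "control w p = X" for p
    using middle_X_le[OF w lt that(1) mid(1,2)[OF that(2)]] pos[OF mid(3)[OF that(2)]] that(3)
    unfolding time_def control_def by blast
  moreover have "(1 - \<kappa> * cos \<alpha>) * sin (time w q) * cos (time w p)
      = (\<kappa> - cos \<alpha>) * cos (time w q) * sin (time w p)"
    if "p \<in> middle w" "q \<in> middle w" "control w p = X \<and> control w q = Y" for p q
    using middle_balanced[OF w lt mid(1,2)[OF that(1)] _ mid(1,2)[OF that(2)]] that(3)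
    unfolding time_def control_def assms(7) by blast
  ultimately show ?thesis using w(2) val by blast
qed

end
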